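(* Consider the weighted recursive tree with i.i.d. vertex-weights $(W_i)_{i\in\mathbb N}$ distributed as $W$, where $W$ satisfies: (1) $W$ takes values in $(0,1]$ and $\sup\{x\in\mathbb R:\mathbb P(W\le x)<1\}=1$; (2) there exist $C,\rho>0$ and $x_1\in(0,1)$ such that $\mathbb P(W\le x)\le Cx^\rho$ for all $x\in[0,x_1]$; (3) the distribution of $W$ belongs to the Weibull maximum domain of attraction, so that there exist $\alpha>1$ and a positive function $\ell$, slowly varying at infinity, such that $\mathbb P(W\ge1-1/x)=\mathbb P((1-W)^{-1}\ge x)=\ell(x)x^{-(\alpha-1)}$ for $x>0$. Then, as $n\to\infty$, $$\max_{i\in[n]}\frac{\mathcal Z_n(i)-\log_\theta n}{\log_\theta\log_\theta n}\xrightarrow{\ \mathbb P\ }-(\alpha-1).$$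
   Context: Weighted recursive tree (WRT): let $(W_i)_{i\ge1}$ be i.i.d. copies of a random variable $W$ with $\mathbb P(W>0)=1$ and $S_n:=\sum_{i=1}^nW_i$. $T_1$ consists of the single vertex $1$ (the root) with vertex-weight $W_1$. For $n\ge1$, $T_{n+1}$ is obtained from $T_n$ by adding vertex $n+1$ with vertex-weight $W_{n+1}$ and, conditionally on $T_n$ (including its vertex-weights), connecting it to one vertex $i\in[n]:=\{1,\ldots,n\}$ chosen with probability $W_i/S_n$, by an edge directed from $n+1$ to $i$. $\mathcal Z_n(i)$ denotes the in-degree of vertex $i$ in $T_n$. Set $\theta:=1+\mathbb E[W]$; $\log_\theta$ is the logarithm to base $\theta$. *)

theory Defs
  imports "HOL-Probability.Probability" "Graph_Theory.Digraph"
begin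

section \<open>The weighted recursive tree\<close>

text \<open>
  \<open>\<mu>\<close> is the law of the generic weight, \<open>W i\<close> is the weight of vertex \<open>i \<ge> 1\<close>, and
  \<open>parent v\<close> is the vertex to which vertex \<open>v \<ge> 2\<close> connects; the values \<open>W 0\<close>, \<open>parent 0\<close> and
  \<open>parent 1\<close> are irrelevant.  Each arc is identified with its tail \<open>v\<close>.
\<close>

definition wrt_tree :: "(nat \<Rightarrow> 'a \<Rightarrow> nat) \<Rightarrow> nat \<Rightarrow> 'a \<Rightarrow> (nat, nat) pre_digraph" where
  "wrt_tree parent n \<omega> =
     \<lparr> verts = {1..n}, arcs = {2..n}, tail = (\<lambda>v. v), head = (\<lambda>v. parent v \<omega>) \<rparr>"

text \<open>
  The information on which the choice of the parent of vertex \<open>n + 1\<close> is conditioned: the tree on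
  \<open>{1..n}\<close> together with all the vertex-weights.  The weights of the vertices \<open>n + 1, n + 2, \<dots>\<close>
  are included because they are sampled independently of the growth of the tree up to that point
  and do not influence the choice of the parent of \<open>n + 1\<close>.
\<close>

definition wrt_history ::
  "'a measure \<Rightarrow> (nat \<Rightarrow> 'a \<Rightarrow> real) \<Rightarrow> (nat \<Rightarrow> 'a \<Rightarrow> nat) \<Rightarrow> nat \<Rightarrow> 'a measure" where
  "wrt_history M W parent n = sigma (space M)
     ({W i -` A \<inter> space M | i A. 1 \<le> i \<and> A \<in> sets borel} \<union>
      {parent v -` A \<inter> space M | v A. v \<in> {2..n}})"

locale weighted_recursive_tree = prob_space M for M :: "'a measure" +
  fixes \<mu> :: "real measure" and W :: "nat \<Rightarrow> 'a \<Rightarrow> real" and parent :: "nat \<Rightarrow> 'a \<Rightarrow> nat"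
  assumes law: "real_distribution \<mu>"
    and law_pos: "AE x in \<mu>. 0 < x"
    and weights_indep: "indep_vars (\<lambda>_. borel) W {1..}"
    and weights_law: "\<And>i. 1 \<le> i \<Longrightarrow> distr M borel (W i) = \<mu>"
    and parent_measurable: "\<And>n. 1 \<le> n \<Longrightarrow> parent (Suc n) \<in> measurable M (count_space UNIV)"
    and parent_range: "\<And>n \<omega>. 1 \<le> n \<Longrightarrow> \<omega> \<in> space M \<Longrightarrow> parent (Suc n) \<omega> \<in> {1..n}"
    and parent_law: "\<And>n i. 1 \<le> n \<Longrightarrow> i \<in> {1..n} \<Longrightarrow>
      AE \<omega> in M. real_cond_exp M (wrt_history M W parent n)
                    (indicator {\<omega> \<in> space M. parent (Suc n) \<omega> = i}) \<omega>
                  = W i \<omega> / (\<Sum>j=1..n. W j \<omega>)"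

lemma (in weighted_recursive_tree) subalgebra_wrt_history:
  "subalgebra M (wrt_history M W parent n)"
proof -
  have W: "W i -` A \<inter> space M \<in> sets M" if "1 \<le> i" "A \<in> sets borel" for i A
    using weights_indep that unfolding indep_vars_def by (auto intro: measurable_sets)
  have p: "parent v -` A \<inter> space M \<in> sets M" if "v \<in> {2..n}" for v A
    using parent_measurable[of "v - 1"] that by (auto intro: measurable_sets)
  show ?thesis
    unfolding subalgebra_def wrt_history_def using W p
    by (subst sets_measure_of) (auto simp: space_measure_of_conv intro!: sets.sigma_sets_subset)
qed

lemma in_degree_wrt_tree: "in_degree (wrt_tree parent n \<omega>) i = card {v \<in> {2..n}. parent v \<omega> = i}"
  by (simp add: in_degree_def in_arcs_def wrt_tree_def)


section \<open>Regularity of the weight distribution, and convergence in probability\<close>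

definition slowly_varying :: "(real \<Rightarrow> real) \<Rightarrow> bool" where
  "slowly_varying L \<longleftrightarrow> (\<forall>c>0. ((\<lambda>x. L (c * x) / L x) \<longlongrightarrow> 1) at_top)"

definition weibull_max_cdf :: "real \<Rightarrow> real \<Rightarrow> real" where
  "weibull_max_cdf \<beta> x = (if x < 0 then exp (- ((- x) powr \<beta>)) else 1)"

text \<open>
  \<open>cdf \<mu> (a n * x + b n) ^ n\<close> is the distribution function at \<open>x\<close> of \<open>(max {X\<^sub>1, \<dots>, X\<^sub>n} - b n) / a n\<close>
  for independent \<open>X\<^sub>1, \<dots>, X\<^sub>n\<close> with law \<open>\<mu>\<close>.
\<close>

definition weibull_max_domain :: "real measure \<Rightarrow> bool" where
  "weibull_max_domain \<mu> \<longleftrightarrow>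
     (\<exists>\<beta>>0. \<exists>a b :: nat \<Rightarrow> real. (\<forall>n. 0 < a n) \<and>
        weak_conv (\<lambda>n x. cdf \<mu> (a n * x + b n) ^ n) (weibull_max_cdf \<beta>))"

text \<open>
  Measurability is required since \<^const>\<open>measure\<close> is \<open>0\<close> on non-measurable sets.
\<close>

definition tendsto_in_prob ::
  "'a measure \<Rightarrow> (nat \<Rightarrow> 'a \<Rightarrow> real) \<Rightarrow> ('a \<Rightarrow> real) \<Rightarrow> bool" where
  "tendsto_in_prob M X Y \<longleftrightarrow>
     (\<forall>n. X n \<in> borel_measurable M) \<and> Y \<in> borel_measurable M \<and>
     (\<forall>\<epsilon>>0. (\<lambda>n. measure M {\<omega> \<in> space M. \<epsilon> < \<bar>X n \<omega> - Y \<omega>\<bar>}) \<longlonglongrightarrow> 0)"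

end

theory Submission
  imports Defs "HOL-Real_Asymp.Real_Asymp"
begin

text \<open>
  Write \<open>m\<close> for the mean weight, so that \<open>\<theta> = 1 + m\<close>, and \<open>S\<^sub>l\<close> for the sum of the first \<open>l\<close> weights.
  Given all the weights, the in-degree of a vertex \<open>i\<close> of weight \<open>w\<close> is a sum of independent Bernoulli
  variables with parameters \<open>w / S\<^sub>l\<close>, \<open>i \<le> l < n\<close> (\<open>expectation_tail\<close>).  If \<open>S\<^sub>l\<close> were equal to
  \<open>m * l\<close>, the sum \<open>T\<^sub>n(k)\<close> over \<open>i \<le> n\<close> of the probabilities that such a variable is at least \<open>k\<close> would
  satisfy
    \<open>T\<^bsub>n+1\<^esub>(k) = (1 - w / (m * n)) * T\<^sub>n(k) + w / (m * n) * T\<^sub>n(k - 1)\<close>,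
  a recursion solved by \<open>n * q(w) ^ k\<close> with \<open>q(w) = w / (m + w)\<close>.  So the expected number of vertices
  of in-degree at least \<open>k\<close> is about \<open>n\<close> times the integral of \<open>q ^ k\<close> against the weight
  distribution.  As \<open>q(w)\<close> is \<open>1 / \<theta>\<close> times a factor of order \<open>exp (- c * (1 - w))\<close>, only weights
  with \<open>1 - w\<close> of order \<open>1 / k\<close> count, and the assumption on the tail makes the integral
  \<open>\<theta> powr (- k) * k powr (- (\<alpha> - 1))\<close> up to a factor \<open>k powr o(1)\<close>.  For
  \<open>k = log \<theta> n - B * log \<theta> (log \<theta> n)\<close> the expected number is therefore the power
  \<open>B - (\<alpha> - 1) + o(1)\<close> of \<open>log \<theta> n\<close>.

  If \<open>B < \<alpha> - 1\<close> this tends to \<open>0\<close>, and the union bound shows that with high probability there is no such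
  vertex (\<open>upper_event_small\<close>).  If \<open>B > \<alpha> - 1\<close> it tends to infinity; since the events that two given
  vertices have large in-degree are negatively correlated given the weights
  (\<open>expectation_tail_pair\<close>), the conditional second moment method yields such a vertex
  (\<open>lower_event_small\<close>).

  The true sums \<open>S\<^sub>l\<close> are controlled by Hoeffding's inequality: with probability close to \<open>1\<close> they
  differ from \<open>m * l\<close> by at most \<open>l powr (2/3)\<close> for all \<open>l\<close> beyond a fixed \<open>J\<close>.  The relative errors
  \<open>l powr (-1/3) / m\<close> are small enough to perturb the solution of the recursion only by a bounded factor
  (\<open>sum_bern_tail_upper\<close>, \<open>sum_bern_tail_lower\<close>), and the first \<open>J\<close> steps change in-degrees by at
  most \<open>J\<close>.
\<close>

section \<open>Tails of sums of independent Bernoulli variables\<close>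

text \<open>
  \<open>bern_tail p n k\<close> is the probability that at least \<open>k\<close> of \<open>n\<close> independent trials succeed, the
  trial with index \<open>l < n\<close> having success probability \<open>p l\<close>.  It is defined by conditioning on the
  last trial, because this recursion is all that is ever used.
\<close>
primrec bern_tail :: "(nat \<Rightarrow> real) \<Rightarrow> nat \<Rightarrow> nat \<Rightarrow> real" where
  "bern_tail p 0 k = (if k = 0 then 1 else 0)"
| "bern_tail p (Suc n) k =
     (case k of 0 \<Rightarrow> 1 | Suc k' \<Rightarrow> (1 - p n) * bern_tail p n (Suc k') + p n * bern_tail p n k')"

lemma bern_tail_0 [simp]: "bern_tail p n 0 = 1"
  by (cases n) auto

lemma bern_tail_Suc [simp]:
  "bern_tail p (Suc n) (Suc k) = (1 - p n) * bern_tail p n (Suc k) + p n * bern_tail p n k"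
  by simp

declare bern_tail.simps(2) [simp del]

lemma bern_tail_bounds:
  assumes "\<And>l. l < n \<Longrightarrow> 0 \<le> p l \<and> p l \<le> 1"
  shows "0 \<le> bern_tail p n k" "bern_tail p n k \<le> 1"
proof -
  have "0 \<le> bern_tail p n k \<and> bern_tail p n k \<le> 1"
    using assms
  proof (induction n arbitrary: k)
    case (Suc n)
    show ?case
    proof (cases k)
      case k: (Suc k')
      have p: "0 \<le> p n" "p n \<le> 1" using Suc.prems by auto
      have b: "0 \<le> bern_tail p n j \<and> bern_tail p n j \<le> 1" for j
        using Suc.IH Suc.prems by simp
      have "(1 - p n) * bern_tail p n (Suc k') + p n * bern_tail p n k' \<le> (1 - p n) * 1 + p n * 1"
        using p b by (intro add_mono mult_left_mono) auto
      moreover have "0 \<le> (1 - p n) * bern_tail p n (Suc k') + p n * bern_tail p n k'"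
        using p b by simp
      ultimately show ?thesis using k by simp
    qed simp
  qed auto
  then show "0 \<le> bern_tail p n k" "bern_tail p n k \<le> 1" by auto
qed

lemma bern_tail_antimono:
  assumes "\<And>l. l < n \<Longrightarrow> 0 \<le> p l \<and> p l \<le> 1"
  shows "bern_tail p n (Suc k) \<le> bern_tail p n k"
  using assms
proof (induction n arbitrary: k)
  case (Suc n)
  have p: "0 \<le> p n" "p n \<le> 1" using Suc.prems by auto
  have IH: "bern_tail p n (Suc j) \<le> bern_tail p n j" for j
    using Suc.IH Suc.prems by simp
  show ?case
  proof (cases k)
    case 0
    have "bern_tail p (Suc n) (Suc 0) \<le> 1"
      using bern_tail_bounds(2)[of "Suc n" p "Suc 0"] Suc.prems by blast
    with 0 show ?thesis by simp
  next
    case k: (Suc k')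
    show ?thesis unfolding k bern_tail_Suc
      using p IH by (intro add_mono mult_left_mono) auto
  qed
qed auto

text \<open>
  Raising \<open>p n\<close> moves mass from the smaller tail \<open>bern_tail p n (Suc k)\<close> to the larger
  \<open>bern_tail p n k\<close>.
\<close>
lemma bern_tail_mono:
  assumes "\<And>l. l < n \<Longrightarrow> 0 \<le> p l \<and> p l \<le> p' l \<and> p' l \<le> 1"
  shows "bern_tail p n k \<le> bern_tail p' n k"
  using assms
proof (induction n arbitrary: k)
  case (Suc n)
  have p: "0 \<le> p n" "p n \<le> p' n" "p' n \<le> 1" using Suc.prems by auto
  have IH: "bern_tail p n j \<le> bern_tail p' n j" for j
    using Suc.IH Suc.prems by simp
  show ?case
  proof (cases k)
    case k: (Suc k')
    have anti: "bern_tail p n (Suc k') \<le> bern_tail p n k'"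
      using Suc.prems by (intro bern_tail_antimono) (meson less_SucI order.trans)
    have "bern_tail p (Suc n) k
        = bern_tail p n (Suc k') + p n * (bern_tail p n k' - bern_tail p n (Suc k'))"
      unfolding k bern_tail_Suc by (simp add: algebra_simps)
    also have "\<dots> \<le> bern_tail p n (Suc k') + p' n * (bern_tail p n k' - bern_tail p n (Suc k'))"
      using p anti by (intro add_left_mono mult_right_mono) auto
    also have "\<dots> = (1 - p' n) * bern_tail p n (Suc k') + p' n * bern_tail p n k'"
      by (simp add: algebra_simps)
    also have "\<dots> \<le> (1 - p' n) * bern_tail p' n (Suc k') + p' n * bern_tail p' n k'"
      using p IH by (intro add_mono mult_left_mono) auto
    finally show ?thesis by (simp add: k)
  qed simp
qed auto

lemma bern_tail_eq_0:
  assumes "n < k"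
  shows "bern_tail p n k = 0"
  using assms
proof (induction n arbitrary: k)
  case (Suc n)
  then obtain k' where "k = Suc k'" "n < k'" by (cases k) auto
  with Suc show ?case by simp
qed auto

text \<open>Trials that cannot succeed do not change the tail.\<close>
lemma bern_tail_skip:
  assumes "m \<le> n" "\<And>l. m \<le> l \<Longrightarrow> l < n \<Longrightarrow> p l = 0"
  shows "bern_tail p n k = bern_tail p m k"
  using assms
proof (induction n arbitrary: k rule: dec_induct)
  case (step n)
  then show ?case by (cases k) (auto simp: step)
qed auto

lemma borel_measurable_bern_tail [measurable]:
  assumes [measurable]: "\<And>l. (\<lambda>\<omega>. p \<omega> l) \<in> borel_measurable N"
  shows "(\<lambda>\<omega>. bern_tail (p \<omega>) n k) \<in> borel_measurable N"
proof (induction n arbitrary: k)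
  case (Suc n)
  note [measurable] = Suc
  show ?case by (cases k) simp_all
qed simp

text \<open>
  The probabilities with which a vertex \<open>i\<close> of weight \<open>w\<close> would attract the vertices \<open>l + 1\<close> if the
  sum of the first \<open>l\<close> weights were the deterministic number \<open>d l\<close> for \<open>l \<ge> J\<close>.  The trials before
  \<open>J\<close> are given the constant probability \<open>e\<close>, which is \<open>1\<close> in the upper and \<open>0\<close> in the lower bound.
\<close>
definition wt_prob :: "nat \<Rightarrow> real \<Rightarrow> (nat \<Rightarrow> real) \<Rightarrow> real \<Rightarrow> nat \<Rightarrow> nat \<Rightarrow> real" where
  "wt_prob J e d w i l = (if l < J then e else if l < i then 0 else w / d l)"

lemma wt_prob_bounds:
  assumes "0 \<le> e" "e \<le> 1" "0 \<le> w" "w \<le> 1" "\<And>l. J \<le> l \<Longrightarrow> 1 \<le> d l"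
  shows "0 \<le> wt_prob J e d w i l" "wt_prob J e d w i l \<le> 1"
proof -
  have "0 \<le> w / d l \<and> w / d l \<le> 1" if "J \<le> l"
    using assms(3,4) assms(5)[OF that] by (auto simp: divide_le_eq_1)
  then show "0 \<le> wt_prob J e d w i l" "wt_prob J e d w i l \<le> 1"
    using assms(1,2) by (auto simp: wt_prob_def not_less)
qed

text \<open>
  Summed over all vertices of the tree, the tails satisfy a closed recursion in \<open>n\<close>: the new vertex
  contributes nothing since it has in-degree \<open>0\<close> (or at most \<open>J\<close>, if \<open>e = 1\<close>).
\<close>
lemma sum_bern_tail_Suc:
  assumes "J \<le> n" "J < Suc k \<or> e = 0"
  shows "(\<Sum>i=1..Suc n. bern_tail (wt_prob J e d w i) (Suc n) (Suc k))
    = (1 - w / d n) * (\<Sum>i=1..n. bern_tail (wt_prob J e d w i) n (Suc k))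
      + w / d n * (\<Sum>i=1..n. bern_tail (wt_prob J e d w i) n k)"
proof -
  have "bern_tail (wt_prob J e d w (Suc n)) (Suc n) (Suc k)
      = bern_tail (wt_prob J e d w (Suc n)) J (Suc k)"
    using assms by (intro bern_tail_skip) (auto simp: wt_prob_def)
  also have "\<dots> = 0"
  proof (cases "e = 0")
    case True
    then have "bern_tail (wt_prob J e d w (Suc n)) J (Suc k)
        = bern_tail (wt_prob J e d w (Suc n)) 0 (Suc k)"
      by (intro bern_tail_skip) (auto simp: wt_prob_def)
    then show ?thesis by simp
  qed (use assms in \<open>auto intro: bern_tail_eq_0\<close>)
  finally have new: "bern_tail (wt_prob J e d w (Suc n)) (Suc n) (Suc k) = 0" .
  have "(\<Sum>i=1..n. bern_tail (wt_prob J e d w i) (Suc n) (Suc k))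
      = (\<Sum>i=1..n. (1 - w / d n) * bern_tail (wt_prob J e d w i) n (Suc k)
                  + w / d n * bern_tail (wt_prob J e d w i) n k)"
    using assms by (intro sum.cong) (auto simp: wt_prob_def)
  then show ?thesis
    using new by (simp add: sum.distrib sum_distrib_left)
qed

text \<open>
  With \<open>d l = m * l\<close> the recursion of the preceding lemma is solved exactly by \<open>n * q ^ k\<close> with
  \<open>q = w / (m + w)\<close>, since \<open>(1 - w / (m * n)) * q + w / (m * n) = q * (1 + 1 / n)\<close>.  If \<open>d l\<close>
  deviates from \<open>m * l\<close>, a factor \<open>exp (x l)\<close> in each step absorbs the error, and the arbitrary
  start at time \<open>J\<close> costs a shift of \<open>k\<close> by \<open>J\<close>.
\<close>
lemma sum_bern_tail_upper:
  fixes m w :: real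
  assumes m: "m > 0" and w: "0 < w" "w \<le> 1" and J: "1 \<le> J"
    and d: "\<And>l. J \<le> l \<Longrightarrow> 1 \<le> d l"
    and x: "\<And>l. J \<le> l \<Longrightarrow> 0 \<le> x l"
    and growth: "\<And>l. J \<le> l \<Longrightarrow> real l * (1 + m / d l) \<le> (real l + 1) * exp (x l)"
    and "J \<le> n" "J \<le> k"
  shows "(\<Sum>i=1..n. bern_tail (wt_prob J 1 d w i) n k)
    \<le> real n * exp (\<Sum>l=J..<n. x l) * (w / (m + w)) ^ (k - J)"
  using \<open>J \<le> n\<close> \<open>J \<le> k\<close>
proof (induction n arbitrary: k rule: dec_induct)
  note bnd = bern_tail_bounds[OF conjI[OF wt_prob_bounds[of 1 w J d]]]
  have le1: "bern_tail (wt_prob J 1 d w i) n k \<le> 1" for i n k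
    using w d by (intro bnd) auto
  {
    case base
    show ?case
    proof (cases "k = J")
      case True
      have "(\<Sum>i=1..J. bern_tail (wt_prob J 1 d w i) J k) \<le> (\<Sum>i=1..J. 1)"
        by (intro sum_mono le1)
      then show ?thesis using True by simp
    next
      case False
      then have "(\<Sum>i=1..J. bern_tail (wt_prob J 1 d w i) J k) = 0"
        using base by (intro sum.neutral) (auto intro: bern_tail_eq_0)
      then show ?thesis using m w by simp
    qed
  next
    case (step n)
    show ?case
    proof (cases "k = J")
      case True
      have "(\<Sum>i=1..Suc n. bern_tail (wt_prob J 1 d w i) (Suc n) k) \<le> (\<Sum>i=1..Suc n. 1)"
        by (intro sum_mono le1)
      also have "\<dots> \<le> real (Suc n) * exp (\<Sum>l=J..<Suc n. x l)"
        using x by (auto simp del: sum.op_ivl_Suc intro!: sum_nonneg)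
      finally show ?thesis using True by simp
    next
      case False
      with step.prems obtain k' where k: "k = Suc k'" "J \<le> k'" by (cases k) auto
      define q where "q = w / (m + w)"
      have q: "0 < q" using m w by (simp add: q_def)
      define p where "p = w / d n"
      have p: "0 \<le> p" "p \<le> 1"
        using w d[of n] step.hyps by (auto simp: p_def divide_le_eq_1)
      define E where "E = exp (\<Sum>l=J..<n. x l)"
      have dn: "d n > 0" using d[of n] step.hyps by simp
      have pq: "(1 - p) * q + p = q * (1 + m / d n)"
      proof -
        have "w - w * q = q * m" using m w by (simp add: q_def field_simps)
        moreover have "(1 - p) * q + p = q + (w - w * q) / d n"
          by (simp add: p_def algebra_simps diff_divide_distrib)
        ultimately have "(1 - p) * q + p = q + q * m / d n" by simp
        then show ?thesis by (simp add: distrib_left)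
      qed
      have "(\<Sum>i=1..Suc n. bern_tail (wt_prob J 1 d w i) (Suc n) (Suc k'))
        \<le> (1 - p) * (real n * E * q ^ Suc (k' - J)) + p * (real n * E * q ^ (k' - J))"
      proof -
        have "(\<Sum>i=1..n. bern_tail (wt_prob J 1 d w i) n (Suc k'))
            \<le> real n * E * q ^ Suc (k' - J)"
          using step.IH[of "Suc k'"] k by (simp only: Suc_diff_le E_def q_def le_SucI)
        moreover have "(\<Sum>i=1..n. bern_tail (wt_prob J 1 d w i) n k')
            \<le> real n * E * q ^ (k' - J)"
          using step.IH[of k'] k by (simp only: E_def q_def)
        ultimately show ?thesis
          using k step.hyps p unfolding p_def
          by (subst sum_bern_tail_Suc) (use k step.hyps in simp, use k step.hyps in simp,
              intro add_mono mult_left_mono, auto simp del: times_divide_eq_left)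
      qed
      also have "\<dots> = real n * E * q ^ (k' - J) * ((1 - p) * q + p)"
        by (simp add: algebra_simps)
      also have "\<dots> = E * q ^ Suc (k' - J) * (real n * (1 + m / d n))"
        unfolding pq by simp
      also have "\<dots> \<le> E * q ^ Suc (k' - J) * ((real n + 1) * exp (x n))"
        using growth[of n] step.hyps q by (intro mult_left_mono) (auto simp: E_def)
      also have "\<dots> = real (Suc n) * exp (\<Sum>l=J..<Suc n. x l) * q ^ (Suc k' - J)"
        using step.hyps k by (simp add: E_def exp_add Suc_diff_le)
      finally show ?thesis unfolding k q_def .
    qed
  }
qed

text \<open>
  The factor \<open>1 + a / n\<close> is dominated by one step of the power function \<open>(n - 1) powr a\<close>.
\<close>
lemma powr_step_le:
  assumes "2 \<le> n" "0 \<le> a"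
  shows "(real n - 1) powr a * (1 + a / real n) \<le> real n powr a"
proof -
  have n: "real n > 1" using assms by simp
  have "ln (1 - 1 / real n) \<le> - (1 / real n)"
    using ln_add_one_self_le_self2[of "- (1 / real n)"] n by simp
  also have "ln (1 - 1 / real n) = ln (real n - 1) - ln (real n)"
    using n by (subst ln_divide_pos[symmetric]) (auto simp: field_simps)
  finally have "a * (1 / real n) \<le> a * (ln (real n) - ln (real n - 1))"
    using assms by (intro mult_left_mono) auto
  then have "exp (a / real n) \<le> exp (a * (ln (real n) - ln (real n - 1)))" by simp
  then have "1 + a / real n \<le> exp (a * (ln (real n) - ln (real n - 1)))"
    using exp_ge_add_one_self[of "a / real n"] by linarith
  then have "(real n - 1) powr a * (1 + a / real n)
      \<le> (real n - 1) powr a * exp (a * (ln (real n) - ln (real n - 1)))"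
    by (intro mult_left_mono) auto
  also have "\<dots> = real n powr a"
    using n by (simp add: powr_def flip: exp_add) (simp add: algebra_simps)
  finally show ?thesis .
qed

text \<open>
  From \<open>n * q ^ k\<close>, reduced by a factor that absorbs the errors \<open>x l\<close>, a supersolution of the
  recursion is subtracted, which compensates for the missing initial values.  It is exponential in \<open>k\<close> with ratio \<open>1 / z\<close> and
  grows in \<open>n\<close> like \<open>n powr ((z - 1) / m)\<close>; for \<open>k\<close> near \<open>log (1 + m) n\<close> and
  \<open>z = sqrt (1 + m)\<close> it is negligible.
\<close>
lemma sum_bern_tail_lower:
  fixes m w z :: real
  assumes m: "m > 0" and w: "0 < w" "w \<le> 1" and J: "2 \<le> J"
    and d: "\<And>l. J \<le> l \<Longrightarrow> 1 \<le> d l" "\<And>l. J \<le> l \<Longrightarrow> m * real l \<le> d l"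
    and x: "\<And>l. J \<le> l \<Longrightarrow> 0 \<le> x l" "\<And>n. (\<Sum>l=J..<n. x l) \<le> 1"
    and growth: "\<And>l. J \<le> l \<Longrightarrow> (real l + 1) * (1 - x l) \<le> real l * (1 + m / d l)"
    and z: "1 \<le> z" "z \<le> 1 + m"
    and "J \<le> n"
  shows "real n * (1 - (\<Sum>l=J..<n. x l)) * (w / (m + w)) ^ k
      - real J * (1 / z) ^ k * (real n - 1) powr ((z - 1) / m)
    \<le> (\<Sum>i=1..n. bern_tail (wt_prob J 0 d w i) n k)"
  using \<open>J \<le> n\<close>
proof (induction n arbitrary: k rule: dec_induct)
  note bnd = bern_tail_bounds[OF conjI[OF wt_prob_bounds[of 0 w J d]]]
  have ge0: "0 \<le> bern_tail (wt_prob J 0 d w i) n k" for i n k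
    using w d by (intro bnd) auto
  define a where "a = (z - 1) / m"
  have a: "0 \<le> a" using z m by (simp add: a_def)
  define q where "q = w / (m + w)"
  have q: "0 < q" "q \<le> 1" using m w by (auto simp: q_def)
  have qz: "q \<le> 1 / z"
  proof -
    have "z * w \<le> (1 + m) * w" using z w by (intro mult_right_mono) auto
    also have "\<dots> \<le> m + w" using m w by (simp add: algebra_simps)
    finally show ?thesis using m w z by (simp add: q_def field_simps)
  qed
  {
    case base
    show ?case
    proof (cases k)
      case 0
      then show ?thesis by simp
    next
      case (Suc k')
      have "q ^ k \<le> (1 / z) ^ k" using qz q by (intro power_mono) auto
      moreover have "1 \<le> (real J - 1) powr a" using J a by (intro ge_one_powr_ge_zero) auto
      ultimately have "q ^ k * 1 \<le> (1 / z) ^ k * (real J - 1) powr a"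
        using z q by (intro mult_mono) auto
      then have "real J * (q ^ k * 1) \<le> real J * ((1 / z) ^ k * (real J - 1) powr a)"
        by (intro mult_left_mono) auto
      moreover have "0 \<le> (\<Sum>i=1..J. bern_tail (wt_prob J 0 d w i) J k)"
        by (intro sum_nonneg ge0)
      ultimately show ?thesis by (simp add: q_def a_def mult.assoc)
    qed
  next
    case (step n)
    have xn: "0 \<le> x n" using x(1) step.hyps by simp
    have S0: "0 \<le> (\<Sum>l=J..<n. x l)" using x by (auto intro!: sum_nonneg)
    show ?case
    proof (cases k)
      case 0
      have "real (Suc n) * (1 - (\<Sum>l=J..<Suc n. x l)) \<le> real (Suc n) * 1"
        using S0 xn step.hyps by (intro mult_left_mono) auto
      moreover have "0 \<le> real J * (real (Suc n) - 1) powr ((z - 1) / m)" by simp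
      moreover have "(\<Sum>i=1..Suc n. bern_tail (wt_prob J 0 d w i) (Suc n) 0) = real (Suc n)"
        by simp
      ultimately show ?thesis
        unfolding 0 power_0 mult_1_right by linarith
    next
      case k: (Suc k')
      define p where "p = w / d n"
      have p: "0 \<le> p" "p \<le> 1"
        using w d(1)[of n] step.hyps by (auto simp: p_def divide_le_eq_1)
      define S where "S = (\<Sum>l=J..<n. x l)"
      have S: "S \<le> 1" "0 \<le> S" using x(2) S0 by (auto simp: S_def)
      have dn: "d n > 0" using d(1)[of n] step.hyps by simp
      have n: "2 \<le> n" using J step.hyps by simp
      have pq: "(1 - p) * q + p = q * (1 + m / d n)"
      proof -
        have "w - w * q = q * m" using m w by (simp add: q_def field_simps)
        moreover have "(1 - p) * q + p = q + (w - w * q) / d n"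
          by (simp add: p_def algebra_simps diff_divide_distrib)
        ultimately have "(1 - p) * q + p = q + q * m / d n" by simp
        then show ?thesis by (simp add: distrib_left)
      qed
      have pz: "1 + (z - 1) * p \<le> 1 + a / real n"
      proof -
        have "p \<le> 1 / d n" using w dn by (simp add: p_def divide_right_mono)
        also have "\<dots> \<le> 1 / (m * real n)"
          using d(2)[of n] step.hyps m n dn by (intro divide_left_mono mult_pos_pos) auto
        finally have "(z - 1) * p \<le> (z - 1) * (1 / (m * real n))"
          using z by (intro mult_left_mono) auto
        then show ?thesis by (simp add: a_def)
      qed
      define h where "h = real J * (1 / z) ^ k' * (real n - 1) powr a"
      have h0: "0 \<le> h" using z by (simp add: h_def)
      have "real (Suc n) * (1 - (\<Sum>l=J..<Suc n. x l)) * q ^ Suc k'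
          \<le> (1 - S) * q ^ Suc k' * ((real n + 1) * (1 - x n))"
      proof -
        have "1 - (\<Sum>l=J..<Suc n. x l) = 1 - S - x n"
          using step.hyps by (simp add: S_def)
        also have "\<dots> \<le> (1 - S) * (1 - x n)"
          using S xn by (simp add: algebra_simps)
        finally have "real (Suc n) * q ^ Suc k' * (1 - (\<Sum>l=J..<Suc n. x l))
          \<le> real (Suc n) * q ^ Suc k' * ((1 - S) * (1 - x n))"
          using q by (intro mult_left_mono) auto
        then show ?thesis by (simp add: algebra_simps del: sum.op_ivl_Suc)
      qed
      also have "\<dots> \<le> (1 - S) * q ^ Suc k' * (real n * (1 + m / d n))"
        using growth[of n] step.hyps q S by (intro mult_left_mono) auto
      also have "\<dots> = real n * (1 - S) * q ^ k' * ((1 - p) * q + p)"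
        unfolding pq by simp
      finally have 1: "real (Suc n) * (1 - (\<Sum>l=J..<Suc n. x l)) * q ^ Suc k'
          \<le> real n * (1 - S) * q ^ k' * ((1 - p) * q + p)" .
      have "(1 - p) * (h / z) + p * h = h / z * (1 + (z - 1) * p)"
        using z by (simp add: field_simps)
      also have "\<dots> \<le> h / z * (1 + a / real n)"
        using pz h0 z by (intro mult_left_mono) auto
      also have "\<dots> = real J * (1 / z) ^ Suc k' * ((real n - 1) powr a * (1 + a / real n))"
        by (simp add: h_def)
      also have "\<dots> \<le> real J * (1 / z) ^ Suc k' * real n powr a"
        using powr_step_le[OF n a] z by (intro mult_left_mono) auto
      finally have 2: "(1 - p) * (h / z) + p * h \<le> real J * (1 / z) ^ Suc k' * real n powr a" .
      have "real (Suc n) * (1 - (\<Sum>l=J..<Suc n. x l)) * q ^ Suc k'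
          - real J * (1 / z) ^ Suc k' * real n powr a
        \<le> real n * (1 - S) * q ^ k' * ((1 - p) * q + p) - ((1 - p) * (h / z) + p * h)"
        using 1 2 by linarith
      also have "\<dots> = (1 - p) * (real n * (1 - S) * q ^ Suc k' - h / z)
          + p * (real n * (1 - S) * q ^ k' - h)"
        by (simp add: algebra_simps)
      also have "\<dots> \<le> (1 - p) * (\<Sum>i=1..n. bern_tail (wt_prob J 0 d w i) n (Suc k'))
          + p * (\<Sum>i=1..n. bern_tail (wt_prob J 0 d w i) n k')"
        using step.IH[of "Suc k'"] step.IH[of k'] p
        by (intro add_mono mult_left_mono) (auto simp: h_def S_def q_def a_def)
      also have "\<dots> = (\<Sum>i=1..Suc n. bern_tail (wt_prob J 0 d w i) (Suc n) (Suc k'))"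
        using step.hyps by (subst sum_bern_tail_Suc) (auto simp: p_def)
      finally show ?thesis unfolding k by (simp add: q_def a_def)
    qed
  }
qed

section \<open>The in-degrees given the weights\<close>

context weighted_recursive_tree
begin

text \<open>
  The in-degree of the vertex \<open>i\<close> in the tree on \<open>{1..n}\<close>.
\<close>
definition deg :: "nat \<Rightarrow> nat \<Rightarrow> 'a \<Rightarrow> nat" where
  "deg n i \<omega> = card {v \<in> {2..n}. parent v \<omega> = i}"

definition weight_sum :: "nat \<Rightarrow> 'a \<Rightarrow> real" where
  "weight_sum n \<omega> = (\<Sum>j=1..n. W j \<omega>)"

text \<open>
  The conditional probability, given the weights, that vertex \<open>l + 1\<close> connects to \<open>i\<close>.  It is
  truncated to \<open>{0..1}\<close> so as to be a probability also on the null set where a weight is not positive.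
\<close>
definition attach_prob :: "nat \<Rightarrow> 'a \<Rightarrow> nat \<Rightarrow> real" where
  "attach_prob i \<omega> l = (if i \<le> l then max 0 (min 1 (W i \<omega> / weight_sum l \<omega>)) else 0)"

abbreviation hist :: "nat \<Rightarrow> 'a measure" where
  "hist \<equiv> wrt_history M W parent"

text \<open>
  The \<open>\<sigma>\<close>-algebra generated by all the weights.
\<close>
abbreviation weights :: "'a measure" where
  "weights \<equiv> wrt_history M W parent 0"

text \<open>
  The indicator that vertex \<open>n + 1\<close> connects to \<open>i\<close>; vertex \<open>1\<close> connects to nobody.
\<close>
definition arrival :: "nat \<Rightarrow> nat \<Rightarrow> 'a \<Rightarrow> real" where
  "arrival n i \<omega> = of_bool (1 \<le> n \<and> parent (Suc n) \<omega> = i)"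

lemma space_hist [simp]: "space (hist n) = space M"
  by (simp add: wrt_history_def space_measure_of_conv)

lemma sets_hist:
  "sets (hist n) = sigma_sets (space M)
     ({W i -` A \<inter> space M | i A. 1 \<le> i \<and> A \<in> sets borel} \<union>
      {parent v -` A \<inter> space M | v A. v \<in> {2..n}})"
  unfolding wrt_history_def by (rule sets_measure_of) auto

lemma subalgebra_hist: "subalgebra (hist n) weights"
  unfolding subalgebra_def sets_hist by (auto intro!: sigma_sets_mono' simp: sets_hist)

lemma weights_hist: "f \<in> borel_measurable weights \<Longrightarrow> f \<in> borel_measurable (hist n)"
  by (rule measurable_from_subalg[OF subalgebra_hist])

lemma hist_M: "f \<in> borel_measurable (hist n) \<Longrightarrow> f \<in> borel_measurable M"
  by (rule measurable_from_subalg[OF subalgebra_wrt_history])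

lemma weights_M: "f \<in> borel_measurable weights \<Longrightarrow> f \<in> borel_measurable M"
  by (rule hist_M[OF weights_hist])

lemma W_weights:
  assumes "1 \<le> i"
  shows "W i \<in> borel_measurable weights"
proof (rule measurableI)
  fix A :: "real set" assume "A \<in> sets borel"
  with assms show "W i -` A \<inter> space weights \<in> sets weights"
    unfolding sets_hist space_hist by (intro sigma_sets.Basic) blast
qed simp

lemma W_borel: "1 \<le> i \<Longrightarrow> W i \<in> borel_measurable M"
  by (rule hist_M[OF W_weights])

lemma parent_hist:
  assumes "v \<in> {2..n}"
  shows "parent v \<in> measurable (hist n) (count_space UNIV)"
proof (rule measurableI)
  fix A :: "nat set"
  from assms show "parent v -` A \<inter> space (hist n) \<in> sets (hist n)"
    unfolding sets_hist space_hist by (intro sigma_sets.Basic) blast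
qed simp

lemma weight_sum_weights: "weight_sum n \<in> borel_measurable weights"
  unfolding weight_sum_def[abs_def] using W_weights by (intro borel_measurable_sum) auto

lemma attach_prob_weights: "1 \<le> i \<Longrightarrow> (\<lambda>\<omega>. attach_prob i \<omega> l) \<in> borel_measurable weights"
  using W_weights[of i] weight_sum_weights[of l] unfolding attach_prob_def[abs_def] by simp

lemma attach_prob_bounds: "0 \<le> attach_prob i \<omega> l" "attach_prob i \<omega> l \<le> 1"
  by (auto simp: attach_prob_def)

lemma tail_weights: "1 \<le> i \<Longrightarrow> (\<lambda>\<omega>. bern_tail (attach_prob i \<omega>) n k) \<in> borel_measurable weights"
  using attach_prob_weights by (intro borel_measurable_bern_tail) auto

lemma tail_bounds: "0 \<le> bern_tail (attach_prob i \<omega>) n k" "bern_tail (attach_prob i \<omega>) n k \<le> 1"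
  using attach_prob_bounds by (auto intro: bern_tail_bounds)

lemma deg_hist: "(\<lambda>\<omega>. of_bool (k \<le> deg n i \<omega>) :: real) \<in> borel_measurable (hist n)"
proof -
  have eq: "real (deg n i \<omega>) = (\<Sum>v=2..n. of_bool (parent v \<omega> = i) :: real)" for \<omega>
    unfolding deg_def by (simp add: Int_def)
  have [measurable]: "parent v \<in> measurable (hist n) (count_space UNIV)" if "v \<in> {2..n}" for v
    using parent_hist that by blast
  have "(\<lambda>\<omega>. \<Sum>v=2..n. of_bool (parent v \<omega> = i) :: real) \<in> borel_measurable (hist n)"
    by (intro borel_measurable_sum) measurable
  then have [measurable]: "(\<lambda>\<omega>. real (deg n i \<omega>)) \<in> borel_measurable (hist n)"
    by (simp add: eq)
  have "(\<lambda>\<omega>. of_bool (real k \<le> real (deg n i \<omega>)) :: real) \<in> borel_measurable (hist n)"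
    by measurable
  then show ?thesis by simp
qed

lemma arrival_M: "arrival n i \<in> borel_measurable M"
proof (cases "1 \<le> n")
  case True
  have [measurable]: "parent (Suc n) \<in> measurable M (count_space UNIV)"
    using parent_measurable[OF True] .
  show ?thesis unfolding arrival_def[abs_def] by measurable
qed (simp add: arrival_def[abs_def])

lemma deg_0 [simp]: "deg 0 i \<omega> = 0"
  by (simp add: deg_def)

lemma deg_Suc: "real (deg (Suc n) i \<omega>) = deg n i \<omega> + arrival n i \<omega>"
proof (cases "1 \<le> n")
  case True
  then have "{2..Suc n} = insert (Suc n) {2..n}" by auto
  then have "{v \<in> {2..Suc n}. parent v \<omega> = i}
      = (if parent (Suc n) \<omega> = i then {Suc n} else {}) \<union> {v \<in> {2..n}. parent v \<omega> = i}"
    by auto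
  then show ?thesis using True unfolding deg_def arrival_def by (auto simp: card_insert_if)
qed (simp add: deg_def arrival_def)

lemma AE_weight: "1 \<le> i \<Longrightarrow> AE x in \<mu>. P x \<Longrightarrow> AE \<omega> in M. P (W i \<omega>)"
  by (rule AE_distrD[OF W_borel, of i P]) (simp_all only: weights_law)

lemma AE_weights_pos: "AE \<omega> in M. \<forall>i\<ge>1. 0 < W i \<omega>"
  using AE_weight[OF _ law_pos] by (subst AE_all_countable) auto

lemma attach_prob_AE:
  assumes "1 \<le> i" "i \<le> n"
  shows "AE \<omega> in M. attach_prob i \<omega> n = W i \<omega> / weight_sum n \<omega>"
  using AE_weights_pos
proof eventually_elim
  case (elim \<omega>)
  have "W i \<omega> \<le> weight_sum n \<omega>" unfolding weight_sum_def
    using assms elim by (intro member_le_sum) (auto intro: less_imp_le)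
  moreover have "0 < W i \<omega>" using elim assms by auto
  ultimately show ?case using assms by (auto simp: attach_prob_def divide_le_eq_1)
qed

lemma attach_prob_add_AE:
  assumes "1 \<le> i" "1 \<le> j" "i \<noteq> j"
  shows "AE \<omega> in M. attach_prob i \<omega> n + attach_prob j \<omega> n \<le> 1"
proof (cases "i \<le> n \<and> j \<le> n")
  case True
  have "AE \<omega> in M. attach_prob i \<omega> n = W i \<omega> / weight_sum n \<omega>" "AE \<omega> in M. attach_prob j \<omega> n = W j \<omega> / weight_sum n \<omega>"
    using True assms attach_prob_AE by auto
  with AE_weights_pos show ?thesis
  proof eventually_elim
    case (elim \<omega>)
    have "sum (\<lambda>l. W l \<omega>) {i, j} \<le> weight_sum n \<omega>" unfolding weight_sum_def
      using assms True elim by (intro sum_mono2) (auto intro: less_imp_le)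
    then have "W i \<omega> + W j \<omega> \<le> weight_sum n \<omega>" "0 < W i \<omega>" "0 < W j \<omega>" using assms elim by auto
    then show ?case using elim by (auto simp: divide_le_eq_1 simp flip: add_divide_distrib)
  qed
next
  case False
  then have "attach_prob i \<omega> n + attach_prob j \<omega> n \<le> 1" for \<omega>
    using attach_prob_bounds(2)[of i \<omega> n] attach_prob_bounds(2)[of j \<omega> n] by (auto simp: attach_prob_def)
  then show ?thesis by simp
qed

lemma integrable_bdd:
  assumes "f \<in> borel_measurable M" "\<And>\<omega>. \<omega> \<in> space M \<Longrightarrow> \<bar>f \<omega>\<bar> \<le> (B::real)"
  shows "integrable M f"
  using assms by (intro integrable_const_bound[of _ B]) auto

lemma expectation_arrival:
  assumes g: "g \<in> borel_measurable (hist n)" "\<And>\<omega>. \<omega> \<in> space M \<Longrightarrow> \<bar>g \<omega>\<bar> \<le> B"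
    and i: "1 \<le> i"
  shows "(\<integral>\<omega>. g \<omega> * arrival n i \<omega> \<partial>M) = (\<integral>\<omega>. g \<omega> * attach_prob i \<omega> n \<partial>M)"
proof (cases "i \<le> n")
  case False
  then have "attach_prob i \<omega> n = 0" "\<omega> \<in> space M \<Longrightarrow> arrival n i \<omega> = 0" for \<omega>
    using parent_range[of n \<omega>] by (auto simp: attach_prob_def arrival_def)
  then show ?thesis by (simp cong: Bochner_Integration.integral_cong)
next
  case True
  then have n: "1 \<le> n" using i by simp
  let ?E = "{\<omega> \<in> space M. parent (Suc n) \<omega> = i}"
  interpret subalg: sigma_finite_subalgebra M "hist n"
    by (rule finite_measure_subalgebra_is_sigma_finite)
       (unfold_locales, rule subalgebra_wrt_history)
  have [measurable]: "parent (Suc n) \<in> measurable M (count_space UNIV)"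
    using parent_measurable[OF n] .
  have E [measurable]: "?E \<in> sets M" by measurable
  have gM [measurable]: "g \<in> borel_measurable M" using hist_M g by blast
  have int: "integrable M (\<lambda>\<omega>. g \<omega> * indicator ?E \<omega>)"
    using g(2) by (intro integrable_bdd[of _ "\<bar>B\<bar>"]) (force simp: indicator_def)+
  have "(\<integral>\<omega>. g \<omega> * arrival n i \<omega> \<partial>M) = (\<integral>\<omega>. g \<omega> * indicator ?E \<omega> \<partial>M)"
    using n by (intro Bochner_Integration.integral_cong) (auto simp: arrival_def indicator_def)
  also have "\<dots> = (\<integral>\<omega>. g \<omega> * real_cond_exp M (hist n) (indicator ?E) \<omega> \<partial>M)"
    using g(1) int by (intro subalg.real_cond_exp_intg(2)[symmetric]) auto
  also have "\<dots> = (\<integral>\<omega>. g \<omega> * attach_prob i \<omega> n \<partial>M)"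
  proof (rule integral_cong_AE)
    have "AE \<omega> in M. real_cond_exp M (hist n) (indicator ?E) \<omega> = W i \<omega> / weight_sum n \<omega>"
      using parent_law[of n i] n True i by (simp add: weight_sum_def)
    with attach_prob_AE[OF i True]
    show "AE \<omega> in M. g \<omega> * real_cond_exp M (hist n) (indicator ?E) \<omega> = g \<omega> * attach_prob i \<omega> n"
      by eventually_elim simp
    show "(\<lambda>\<omega>. g \<omega> * real_cond_exp M (hist n) (indicator ?E) \<omega>) \<in> borel_measurable M"
      by measurable
    have [measurable]: "(\<lambda>\<omega>. attach_prob i \<omega> n) \<in> borel_measurable M"
      using attach_prob_weights[OF i] hist_M by blast
    show "(\<lambda>\<omega>. g \<omega> * attach_prob i \<omega> n) \<in> borel_measurable M" by measurable
  qed
  finally show ?thesis .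
qed

lemma of_bool_deg_Suc:
  "(of_bool (Suc k \<le> deg (Suc n) i \<omega>) :: real) = of_bool (Suc k \<le> deg n i \<omega>)
     + (of_bool (k \<le> deg n i \<omega>) - of_bool (Suc k \<le> deg n i \<omega>)) * arrival n i \<omega>"
proof -
  have "deg (Suc n) i \<omega> = deg n i \<omega> + (if 1 \<le> n \<and> parent (Suc n) \<omega> = i then 1 else 0)"
    using deg_Suc[of n i \<omega>] unfolding arrival_def by (auto split: if_splits)
  then show ?thesis by (auto simp: arrival_def)
qed

lemma deg_M: "(\<lambda>\<omega>. of_bool (k \<le> deg n i \<omega>) :: real) \<in> borel_measurable M"
  by (rule hist_M[OF deg_hist])

lemma abs_mult_le:
  fixes a b B :: real
  assumes "\<bar>a\<bar> \<le> B" "0 \<le> b" "b \<le> 1"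
  shows "\<bar>a * b\<bar> \<le> B"
proof -
  have "\<bar>a * b\<bar> = \<bar>a\<bar> * b" using assms by (simp add: abs_mult)
  also have "\<dots> \<le> \<bar>a\<bar> * 1" using assms by (intro mult_left_mono) auto
  finally show ?thesis using assms by simp
qed

lemma integrable_bdd_mult:
  assumes "f \<in> borel_measurable M" "\<And>\<omega>. \<omega> \<in> space M \<Longrightarrow> \<bar>f \<omega>\<bar> \<le> (B::real)"
    and "u \<in> borel_measurable M" "\<And>\<omega>. \<omega> \<in> space M \<Longrightarrow> 0 \<le> u \<omega> \<and> u \<omega> \<le> (1::real)"
  shows "integrable M (\<lambda>\<omega>. f \<omega> * u \<omega>)"
  using assms by (intro integrable_bdd[where B = B] borel_measurable_times abs_mult_le) auto

lemma integral_add3: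
  fixes f g h :: "'a \<Rightarrow> real"
  assumes "integrable M f" "integrable M g" "integrable M h"
  shows "(\<integral>\<omega>. f \<omega> + g \<omega> + h \<omega> \<partial>M) = (\<integral>\<omega>. f \<omega> \<partial>M) + (\<integral>\<omega>. g \<omega> \<partial>M) + (\<integral>\<omega>. h \<omega> \<partial>M)"
  using assms by simp

text \<open>
  One step of the growth, in an integrated form: averaging over the choice of the parent of
  \<open>n + 1\<close> replaces its indicator by the attachment probability.
\<close>
lemma expectation_deg_Suc:
  assumes g: "g \<in> borel_measurable (hist n)" "\<And>\<omega>. \<omega> \<in> space M \<Longrightarrow> \<bar>g \<omega>\<bar> \<le> B"
    and i: "1 \<le> i"
  shows "(\<integral>\<omega>. g \<omega> * of_bool (Suc k \<le> deg (Suc n) i \<omega>) \<partial>M)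
    = (\<integral>\<omega>. (g \<omega> * (1 - attach_prob i \<omega> n)) * of_bool (Suc k \<le> deg n i \<omega>) \<partial>M)
      + (\<integral>\<omega>. (g \<omega> * attach_prob i \<omega> n) * of_bool (k \<le> deg n i \<omega>) \<partial>M)"
proof -
  define u where "u = (\<lambda>\<omega>. of_bool (Suc k \<le> deg n i \<omega>) :: real)"
  define v where "v = (\<lambda>\<omega>. of_bool (k \<le> deg n i \<omega>) :: real)"
  define p where "p = (\<lambda>\<omega>. attach_prob i \<omega> n)"
  define A where "A = arrival n i"
  have uv: "0 \<le> u \<omega> \<and> u \<omega> \<le> 1" "0 \<le> v \<omega> \<and> v \<omega> \<le> 1" "0 \<le> v \<omega> - u \<omega> \<and> v \<omega> - u \<omega> \<le> 1" for \<omega>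
    by (auto simp: u_def v_def)
  have pA: "0 \<le> p \<omega> \<and> p \<omega> \<le> 1" "0 \<le> A \<omega> \<and> A \<omega> \<le> 1" for \<omega>
    by (auto simp: p_def A_def attach_prob_bounds arrival_def)
  have uh: "u \<in> borel_measurable (hist n)" "v \<in> borel_measurable (hist n)"
    unfolding u_def v_def by (rule deg_hist)+
  have meas: "u \<in> borel_measurable M" "v \<in> borel_measurable M" "p \<in> borel_measurable M"
      "A \<in> borel_measurable M" "g \<in> borel_measurable M"
    using uh hist_M g attach_prob_weights[OF i] arrival_M by (auto simp: p_def A_def)
  have gh: "(\<lambda>\<omega>. g \<omega> * (v \<omega> - u \<omega>)) \<in> borel_measurable (hist n)"
    using g uh by (intro borel_measurable_times borel_measurable_diff)
  have gb: "\<bar>g \<omega> * (v \<omega> - u \<omega>)\<bar> \<le> B" "\<bar>g \<omega> * (1 - p \<omega>)\<bar> \<le> B" "\<bar>g \<omega> * p \<omega>\<bar> \<le> B"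
    if "\<omega> \<in> space M" for \<omega>
    using g(2)[OF that] uv[of \<omega>] pA[of \<omega>] by (intro abs_mult_le; simp)+
  have gm: "(\<lambda>\<omega>. g \<omega> * (v \<omega> - u \<omega>)) \<in> borel_measurable M"
      "(\<lambda>\<omega>. g \<omega> * (1 - p \<omega>)) \<in> borel_measurable M" "(\<lambda>\<omega>. g \<omega> * p \<omega>) \<in> borel_measurable M"
    using meas by (intro borel_measurable_times borel_measurable_diff borel_measurable_const; simp)+
  have 1: "integrable M (\<lambda>\<omega>. g \<omega> * u \<omega>)"
    using g(2) meas uv by (intro integrable_bdd_mult[where B = B]) auto
  have 2: "integrable M (\<lambda>\<omega>. g \<omega> * (v \<omega> - u \<omega>) * A \<omega>)"
    by (intro integrable_bdd_mult[where B = B] gm gb meas pA)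
  have 3: "integrable M (\<lambda>\<omega>. g \<omega> * (v \<omega> - u \<omega>) * p \<omega>)"
    by (intro integrable_bdd_mult[where B = B] gm gb meas pA)
  have 4: "integrable M (\<lambda>\<omega>. g \<omega> * (1 - p \<omega>) * u \<omega>)"
    by (intro integrable_bdd_mult[where B = B] gm gb meas uv)
  have 5: "integrable M (\<lambda>\<omega>. g \<omega> * p \<omega> * v \<omega>)"
    by (rule integrable_bdd_mult[OF gm(3) gb(3) meas(2) uv(2)])
  have "(\<integral>\<omega>. g \<omega> * of_bool (Suc k \<le> deg (Suc n) i \<omega>) \<partial>M)
      = (\<integral>\<omega>. g \<omega> * u \<omega> + g \<omega> * (v \<omega> - u \<omega>) * A \<omega> \<partial>M)"
    by (intro Bochner_Integration.integral_cong)
       (simp_all only: of_bool_deg_Suc u_def v_def A_def distrib_left mult.assoc)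
  also have "\<dots> = (\<integral>\<omega>. g \<omega> * u \<omega> \<partial>M) + (\<integral>\<omega>. g \<omega> * (v \<omega> - u \<omega>) * A \<omega> \<partial>M)"
    by (intro Bochner_Integration.integral_add 1 2)
  also have "(\<integral>\<omega>. g \<omega> * (v \<omega> - u \<omega>) * A \<omega> \<partial>M) = (\<integral>\<omega>. g \<omega> * (v \<omega> - u \<omega>) * p \<omega> \<partial>M)"
    unfolding A_def p_def by (intro expectation_arrival[where B = B] gh gb i)
  also have "(\<integral>\<omega>. g \<omega> * u \<omega> \<partial>M) + \<dots> = (\<integral>\<omega>. g \<omega> * u \<omega> + g \<omega> * (v \<omega> - u \<omega>) * p \<omega> \<partial>M)"
    by (intro Bochner_Integration.integral_add[symmetric] 1 3)
  also have "\<dots> = (\<integral>\<omega>. g \<omega> * (1 - p \<omega>) * u \<omega> + g \<omega> * p \<omega> * v \<omega> \<partial>M)"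
    by (intro Bochner_Integration.integral_cong) (auto simp: algebra_simps)
  also have "\<dots> = (\<integral>\<omega>. g \<omega> * (1 - p \<omega>) * u \<omega> \<partial>M) + (\<integral>\<omega>. g \<omega> * p \<omega> * v \<omega> \<partial>M)"
    by (intro Bochner_Integration.integral_add 4 5)
  finally show ?thesis by (simp only: u_def v_def p_def)
qed

text \<open>
  Conditionally on the weights, the in-degree of \<open>i\<close> is a sum of independent Bernoulli variables;
  the conditional law is expressed by testing against the functions \<open>\<phi>\<close> of the weights.  The induction
  works since \<open>\<phi>\<close> times an attachment probability is again a function of the weights.
\<close>
lemma expectation_tail:
  assumes "\<phi> \<in> borel_measurable weights" "\<And>\<omega>. \<omega> \<in> space M \<Longrightarrow> \<bar>\<phi> \<omega>\<bar> \<le> B" "1 \<le> i"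
  shows "(\<integral>\<omega>. \<phi> \<omega> * of_bool (k \<le> deg n i \<omega>) \<partial>M) = (\<integral>\<omega>. \<phi> \<omega> * bern_tail (attach_prob i \<omega>) n k \<partial>M)"
  using assms(1,2)
proof (induction n arbitrary: k \<phi>)
  case (Suc n)
  note i = \<open>1 \<le> i\<close>
  show ?case
  proof (cases k)
    case k: (Suc k')
    define p where "p = (\<lambda>\<omega>. attach_prob i \<omega> n)"
    have p01: "0 \<le> p \<omega> \<and> p \<omega> \<le> 1" for \<omega> by (auto simp: p_def attach_prob_bounds)
    have pw: "p \<in> borel_measurable weights" using attach_prob_weights i by (simp add: p_def)
    have \<phi>p: "(\<lambda>\<omega>. \<phi> \<omega> * (1 - p \<omega>)) \<in> borel_measurable weights" "(\<lambda>\<omega>. \<phi> \<omega> * p \<omega>) \<in> borel_measurable weights"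
      by (intro borel_measurable_times borel_measurable_diff borel_measurable_const Suc.prems(1) pw)+
    have b: "\<bar>\<phi> \<omega> * (1 - p \<omega>)\<bar> \<le> B" "\<bar>\<phi> \<omega> * p \<omega>\<bar> \<le> B" if "\<omega> \<in> space M" for \<omega>
      using Suc.prems(2)[OF that] p01[of \<omega>] by (auto intro!: abs_mult_le)
    have int: "integrable M (\<lambda>\<omega>. \<phi> \<omega> * (1 - p \<omega>) * bern_tail (attach_prob i \<omega>) n k)"
        "integrable M (\<lambda>\<omega>. \<phi> \<omega> * p \<omega> * bern_tail (attach_prob i \<omega>) n k')"
      by (rule integrable_bdd_mult[OF weights_M[OF \<phi>p(1)] b(1) weights_M[OF tail_weights[OF i]]];
          simp add: tail_bounds)
         (rule integrable_bdd_mult[OF weights_M[OF \<phi>p(2)] b(2) weights_M[OF tail_weights[OF i]]];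
          simp add: tail_bounds)
    have "(\<integral>\<omega>. \<phi> \<omega> * of_bool (k \<le> deg (Suc n) i \<omega>) \<partial>M)
      = (\<integral>\<omega>. \<phi> \<omega> * (1 - p \<omega>) * of_bool (k \<le> deg n i \<omega>) \<partial>M)
        + (\<integral>\<omega>. \<phi> \<omega> * p \<omega> * of_bool (k' \<le> deg n i \<omega>) \<partial>M)"
      unfolding k p_def using Suc.prems weights_hist i
      by (intro expectation_deg_Suc[where B = B]) auto
    also have "(\<integral>\<omega>. \<phi> \<omega> * (1 - p \<omega>) * of_bool (k \<le> deg n i \<omega>) \<partial>M)
        = (\<integral>\<omega>. \<phi> \<omega> * (1 - p \<omega>) * bern_tail (attach_prob i \<omega>) n k \<partial>M)"
      by (intro Suc.IH b \<phi>p)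
    also have "(\<integral>\<omega>. \<phi> \<omega> * p \<omega> * of_bool (k' \<le> deg n i \<omega>) \<partial>M)
        = (\<integral>\<omega>. \<phi> \<omega> * p \<omega> * bern_tail (attach_prob i \<omega>) n k' \<partial>M)"
      by (intro Suc.IH b \<phi>p)
    also have "(\<integral>\<omega>. \<phi> \<omega> * (1 - p \<omega>) * bern_tail (attach_prob i \<omega>) n k \<partial>M) + \<dots>
        = (\<integral>\<omega>. \<phi> \<omega> * (1 - p \<omega>) * bern_tail (attach_prob i \<omega>) n k
            + \<phi> \<omega> * p \<omega> * bern_tail (attach_prob i \<omega>) n k' \<partial>M)"
      by (intro Bochner_Integration.integral_add[symmetric] int)
    also have "\<dots> = (\<integral>\<omega>. \<phi> \<omega> * bern_tail (attach_prob i \<omega>) (Suc n) k \<partial>M)"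
      by (intro Bochner_Integration.integral_cong) (auto simp: k p_def algebra_simps)
    finally show ?thesis .
  qed simp
qed simp

end

text \<open>
  The difference of the two sides is \<open>p * q * (r' - r) * (t' - t)\<close>.
\<close>
lemma negative_dependence_step:
  fixes p q r r' t t' :: real
  assumes "0 \<le> p" "0 \<le> q" "r \<le> r'" "t \<le> t'"
  shows "(1 - p - q) * (r * t) + p * (r' * t) + q * (r * t')
    \<le> ((1 - p) * r + p * r') * ((1 - q) * t + q * t')"
proof -
  have "((1 - p) * r + p * r') * ((1 - q) * t + q * t')
      - ((1 - p - q) * (r * t) + p * (r' * t) + q * (r * t')) = (p * q) * ((r' - r) * (t' - t))"
    by algebra
  moreover have "0 \<le> (p * q) * ((r' - r) * (t' - t))"
    using assms by (intro mult_nonneg_nonneg) auto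
  ultimately show ?thesis by linarith
qed

context weighted_recursive_tree
begin

text \<open>
  Conditionally on the weights, the events that two given vertices have large in-degree are negatively
  correlated, because no vertex connects to both of them.
\<close>
lemma expectation_tail_pair:
  assumes "\<phi> \<in> borel_measurable weights" "\<And>\<omega>. \<omega> \<in> space M \<Longrightarrow> 0 \<le> \<phi> \<omega> \<and> \<phi> \<omega> \<le> B"
    and ij: "1 \<le> i" "1 \<le> j" "i \<noteq> j"
  shows "(\<integral>\<omega>. \<phi> \<omega> * (of_bool (a \<le> deg n i \<omega>) * of_bool (b \<le> deg n j \<omega>)) \<partial>M)
    \<le> (\<integral>\<omega>. \<phi> \<omega> * (bern_tail (attach_prob i \<omega>) n a * bern_tail (attach_prob j \<omega>) n b) \<partial>M)"
  using assms(1,2)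
proof (induction n arbitrary: a b \<phi>)
  case 0
  show ?case by (cases a; cases b) auto
next
  case (Suc n)
  have \<phi>B: "\<bar>\<phi> \<omega>\<bar> \<le> B" if "\<omega> \<in> space M" for \<omega> using Suc.prems(2)[OF that] by simp
  consider "a = 0" | "b = 0" | a' b' where "a = Suc a'" "b = Suc b'"
    by (cases a; cases b) auto
  then show ?case
  proof cases
    case 1
    then show ?thesis using expectation_tail[OF Suc.prems(1) \<phi>B ij(2)] by simp
  next
    case 2
    then show ?thesis using expectation_tail[OF Suc.prems(1) \<phi>B ij(1)] by simp
  next
    case (3 a' b')
    define p where "p = (\<lambda>\<omega>. attach_prob i \<omega> n)"
    define q where "q = (\<lambda>\<omega>. attach_prob j \<omega> n)"
    define s where "s = (\<lambda>\<omega>. max 0 (1 - p \<omega> - q \<omega>))"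
    define X where "X = arrival n i"
    define Y where "Y = arrival n j"
    define U where "U = (\<lambda>a b \<omega>. of_bool (a \<le> deg n i \<omega>) * of_bool (b \<le> deg n j \<omega>) :: real)"
    define T where "T = (\<lambda>a b \<omega>. bern_tail (attach_prob i \<omega>) n a * bern_tail (attach_prob j \<omega>) n b)"
    have p01: "0 \<le> p \<omega> \<and> p \<omega> \<le> 1" "0 \<le> q \<omega> \<and> q \<omega> \<le> 1" "0 \<le> s \<omega> \<and> s \<omega> \<le> 1" for \<omega>
      using attach_prob_bounds[of i \<omega> n] attach_prob_bounds[of j \<omega> n] by (auto simp: p_def q_def s_def)
    have X01: "0 \<le> X \<omega> \<and> X \<omega> \<le> 1" "0 \<le> Y \<omega> \<and> Y \<omega> \<le> 1" for \<omega>
      by (auto simp: X_def Y_def arrival_def)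
    have U01: "0 \<le> U a b \<omega> \<and> U a b \<omega> \<le> 1" for a b \<omega>
      by (auto simp: U_def)
    have T01: "0 \<le> T a b \<omega> \<and> T a b \<omega> \<le> 1" for a b \<omega>
      using tail_bounds by (auto simp: T_def mult_le_one)
    have dU: "0 \<le> U a' b \<omega> - U a b \<omega> \<and> U a' b \<omega> - U a b \<omega> \<le> 1"
        "0 \<le> U a b' \<omega> - U a b \<omega> \<and> U a b' \<omega> - U a b \<omega> \<le> 1" for \<omega>
      by (auto simp: U_def 3)
    have pw: "p \<in> borel_measurable weights" "q \<in> borel_measurable weights"
      using attach_prob_weights ij by (auto simp: p_def q_def)
    then have sw: "s \<in> borel_measurable weights"
      unfolding s_def by (intro borel_measurable_max borel_measurable_diff borel_measurable_const)
    have Uh: "U a b \<in> borel_measurable (hist n)" for a b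
      unfolding U_def by (intro borel_measurable_times deg_hist)
    have Tw: "T a b \<in> borel_measurable weights" for a b
      unfolding T_def using ij by (intro borel_measurable_times tail_weights)
    have \<phi>w: "(\<lambda>\<omega>. \<phi> \<omega> * p \<omega>) \<in> borel_measurable weights" "(\<lambda>\<omega>. \<phi> \<omega> * q \<omega>) \<in> borel_measurable weights"
        "(\<lambda>\<omega>. \<phi> \<omega> * s \<omega>) \<in> borel_measurable weights"
      using Suc.prems(1) pw sw by (intro borel_measurable_times; simp)+
    have \<phi>0: "0 \<le> \<phi> \<omega> * r \<and> \<phi> \<omega> * r \<le> B" if "\<omega> \<in> space M" "0 \<le> r \<and> r \<le> 1" for \<omega> r
      using abs_mult_le[OF \<phi>B[OF that(1)], of r] Suc.prems(2)[OF that(1)] that(2) by auto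
    then have \<phi>b: "\<bar>\<phi> \<omega> * r\<bar> \<le> B" if "\<omega> \<in> space M" "0 \<le> r \<and> r \<le> 1" for \<omega> r
      using that by fastforce
    have M: "X \<in> borel_measurable M" "Y \<in> borel_measurable M" "p \<in> borel_measurable M"
        "q \<in> borel_measurable M" "s \<in> borel_measurable M" "\<phi> \<in> borel_measurable M"
        "U a b \<in> borel_measurable M" "T a b \<in> borel_measurable M" for a b
      using arrival_M hist_M[OF Uh] weights_M[OF Tw] weights_M pw sw Suc.prems(1)
      by (auto simp: X_def Y_def)
    have dUh: "(\<lambda>\<omega>. \<phi> \<omega> * (U a' b \<omega> - U a b \<omega>)) \<in> borel_measurable (hist n)"
        "(\<lambda>\<omega>. \<phi> \<omega> * (U a b' \<omega> - U a b \<omega>)) \<in> borel_measurable (hist n)"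
      by (intro borel_measurable_times borel_measurable_diff weights_hist[OF Suc.prems(1)] Uh)+
    have int1: "integrable M (\<lambda>\<omega>. \<phi> \<omega> * r \<omega> * r' \<omega>)"
      if "r \<in> borel_measurable M" "\<And>\<omega>. 0 \<le> r \<omega> \<and> r \<omega> \<le> 1"
        "r' \<in> borel_measurable M" "\<And>\<omega>. 0 \<le> r' \<omega> \<and> r' \<omega> \<le> 1" for r r'
      by (intro integrable_bdd_mult[where B = B] borel_measurable_times \<phi>b that M(6))
    have int0: "integrable M (\<lambda>\<omega>. \<phi> \<omega> * r \<omega>)"
      if "r \<in> borel_measurable M" "\<And>\<omega>. 0 \<le> r \<omega> \<and> r \<omega> \<le> 1" for r
      using int1[OF that, of "\<lambda>_. 1"] by simp
    have dM: "(\<lambda>\<omega>. U a' b \<omega> - U a b \<omega>) \<in> borel_measurable M"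
        "(\<lambda>\<omega>. U a b' \<omega> - U a b \<omega>) \<in> borel_measurable M"
      by (intro borel_measurable_diff M)+
    have bool: "of_bool (a \<le> deg (Suc n) i \<omega>) * of_bool (b \<le> deg (Suc n) j \<omega>)
        = U a b \<omega> + (U a' b \<omega> - U a b \<omega>) * X \<omega> + (U a b' \<omega> - U a b \<omega>) * Y \<omega>" for \<omega>
    proof -
      have "X \<omega> = 0 \<or> Y \<omega> = 0" using ij by (auto simp: X_def Y_def arrival_def)
      then show ?thesis
        unfolding 3 of_bool_deg_Suc U_def X_def[symmetric] Y_def[symmetric]
        by (auto simp: algebra_simps)
    qed
    have "(\<integral>\<omega>. \<phi> \<omega> * (of_bool (a \<le> deg (Suc n) i \<omega>) * of_bool (b \<le> deg (Suc n) j \<omega>)) \<partial>M)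
        = (\<integral>\<omega>. (\<phi> \<omega> * U a b \<omega> + \<phi> \<omega> * (U a' b \<omega> - U a b \<omega>) * X \<omega>)
            + \<phi> \<omega> * (U a b' \<omega> - U a b \<omega>) * Y \<omega> \<partial>M)"
      by (simp only: bool distrib_left mult.assoc)
    also have "\<dots> = (\<integral>\<omega>. \<phi> \<omega> * U a b \<omega> \<partial>M) + (\<integral>\<omega>. \<phi> \<omega> * (U a' b \<omega> - U a b \<omega>) * X \<omega> \<partial>M)
        + (\<integral>\<omega>. \<phi> \<omega> * (U a b' \<omega> - U a b \<omega>) * Y \<omega> \<partial>M)"
      by (intro integral_add3 int0 int1 M dM U01 X01 dU)
    also have "(\<integral>\<omega>. \<phi> \<omega> * (U a' b \<omega> - U a b \<omega>) * X \<omega> \<partial>M)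
        = (\<integral>\<omega>. \<phi> \<omega> * (U a' b \<omega> - U a b \<omega>) * p \<omega> \<partial>M)"
      unfolding X_def p_def using ij by (intro expectation_arrival[where B = B] dUh \<phi>b dU)
    also have "(\<integral>\<omega>. \<phi> \<omega> * (U a b' \<omega> - U a b \<omega>) * Y \<omega> \<partial>M)
        = (\<integral>\<omega>. \<phi> \<omega> * (U a b' \<omega> - U a b \<omega>) * q \<omega> \<partial>M)"
      unfolding Y_def q_def using ij by (intro expectation_arrival[where B = B] dUh \<phi>b dU)
    also have "(\<integral>\<omega>. \<phi> \<omega> * U a b \<omega> \<partial>M) + (\<integral>\<omega>. \<phi> \<omega> * (U a' b \<omega> - U a b \<omega>) * p \<omega> \<partial>M)
        + (\<integral>\<omega>. \<phi> \<omega> * (U a b' \<omega> - U a b \<omega>) * q \<omega> \<partial>M)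
        = (\<integral>\<omega>. (\<phi> \<omega> * U a b \<omega> + \<phi> \<omega> * (U a' b \<omega> - U a b \<omega>) * p \<omega>)
            + \<phi> \<omega> * (U a b' \<omega> - U a b \<omega>) * q \<omega> \<partial>M)"
      by (intro integral_add3[symmetric] int0 int1 M dM U01 p01 dU)
    also have "\<dots> = (\<integral>\<omega>. (\<phi> \<omega> * s \<omega> * U a b \<omega> + \<phi> \<omega> * p \<omega> * U a' b \<omega>)
            + \<phi> \<omega> * q \<omega> * U a b' \<omega> \<partial>M)"
    proof (rule integral_cong_AE)
      show "AE \<omega> in M. (\<phi> \<omega> * U a b \<omega> + \<phi> \<omega> * (U a' b \<omega> - U a b \<omega>) * p \<omega>)
            + \<phi> \<omega> * (U a b' \<omega> - U a b \<omega>) * q \<omega>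
          = (\<phi> \<omega> * s \<omega> * U a b \<omega> + \<phi> \<omega> * p \<omega> * U a' b \<omega>) + \<phi> \<omega> * q \<omega> * U a b' \<omega>"
        using attach_prob_add_AE[OF ij, of n]
      proof eventually_elim
        case (elim \<omega>)
        then have s: "s \<omega> = 1 - p \<omega> - q \<omega>" by (simp add: s_def p_def q_def)
        show ?case unfolding s by (simp add: algebra_simps)
      qed
    qed (intro borel_measurable_add borel_measurable_times M dM)+
    also have "\<dots> = (\<integral>\<omega>. \<phi> \<omega> * s \<omega> * U a b \<omega> \<partial>M) + (\<integral>\<omega>. \<phi> \<omega> * p \<omega> * U a' b \<omega> \<partial>M)
        + (\<integral>\<omega>. \<phi> \<omega> * q \<omega> * U a b' \<omega> \<partial>M)"
      by (intro integral_add3 int1 M U01 p01)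
    also have "\<dots> \<le> (\<integral>\<omega>. \<phi> \<omega> * s \<omega> * T a b \<omega> \<partial>M) + (\<integral>\<omega>. \<phi> \<omega> * p \<omega> * T a' b \<omega> \<partial>M)
        + (\<integral>\<omega>. \<phi> \<omega> * q \<omega> * T a b' \<omega> \<partial>M)"
      unfolding U_def T_def by (intro add_mono Suc.IH \<phi>w \<phi>0 p01)
    also have "\<dots> = (\<integral>\<omega>. (\<phi> \<omega> * s \<omega> * T a b \<omega> + \<phi> \<omega> * p \<omega> * T a' b \<omega>)
            + \<phi> \<omega> * q \<omega> * T a b' \<omega> \<partial>M)"
      by (intro integral_add3[symmetric] int1 M T01 p01)
    also have "\<dots> \<le> (\<integral>\<omega>. \<phi> \<omega> * (bern_tail (attach_prob i \<omega>) (Suc n) a * bern_tail (attach_prob j \<omega>) (Suc n) b) \<partial>M)"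
    proof (rule integral_mono_AE)
      show "integrable M (\<lambda>\<omega>. \<phi> \<omega> * (bern_tail (attach_prob i \<omega>) (Suc n) a * bern_tail (attach_prob j \<omega>) (Suc n) b))"
        by (intro int0 borel_measurable_times weights_M tail_weights ij conjI mult_nonneg_nonneg
            mult_le_one tail_bounds)
      show "integrable M (\<lambda>\<omega>. (\<phi> \<omega> * s \<omega> * T a b \<omega> + \<phi> \<omega> * p \<omega> * T a' b \<omega>) + \<phi> \<omega> * q \<omega> * T a b' \<omega>)"
        by (intro Bochner_Integration.integrable_add int1 M T01 p01)
      show "AE \<omega> in M. (\<phi> \<omega> * s \<omega> * T a b \<omega> + \<phi> \<omega> * p \<omega> * T a' b \<omega>) + \<phi> \<omega> * q \<omega> * T a b' \<omega>
          \<le> \<phi> \<omega> * (bern_tail (attach_prob i \<omega>) (Suc n) a * bern_tail (attach_prob j \<omega>) (Suc n) b)"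
        using attach_prob_add_AE[OF ij, of n] AE_space
      proof eventually_elim
        case (elim \<omega>)
        then have s: "s \<omega> = 1 - p \<omega> - q \<omega>" by (simp add: s_def p_def q_def)
        define r where "r = bern_tail (attach_prob i \<omega>) n a"
        define r' where "r' = bern_tail (attach_prob i \<omega>) n a'"
        define t where "t = bern_tail (attach_prob j \<omega>) n b"
        define t' where "t' = bern_tail (attach_prob j \<omega>) n b'"
        have "r \<le> r'" "t \<le> t'"
          unfolding r_def r'_def t_def t'_def 3 using attach_prob_bounds by (auto intro!: bern_tail_antimono)
        then have "s \<omega> * (r * t) + p \<omega> * (r' * t) + q \<omega> * (r * t')
            \<le> ((1 - p \<omega>) * r + p \<omega> * r') * ((1 - q \<omega>) * t + q \<omega> * t')"
          unfolding s using p01[of \<omega>] by (intro negative_dependence_step) auto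
        also have "\<dots> = bern_tail (attach_prob i \<omega>) (Suc n) a * bern_tail (attach_prob j \<omega>) (Suc n) b"
          by (simp add: 3 r_def r'_def t_def t'_def p_def q_def)
        finally have "\<phi> \<omega> * (s \<omega> * (r * t) + p \<omega> * (r' * t) + q \<omega> * (r * t'))
            \<le> \<phi> \<omega> * (bern_tail (attach_prob i \<omega>) (Suc n) a * bern_tail (attach_prob j \<omega>) (Suc n) b)"
          using Suc.prems(2)[OF elim(2)] by (intro mult_left_mono) auto
        moreover have "\<phi> \<omega> * s \<omega> * T a b \<omega> + \<phi> \<omega> * p \<omega> * T a' b \<omega> + \<phi> \<omega> * q \<omega> * T a b' \<omega>
            = \<phi> \<omega> * (s \<omega> * (r * t) + p \<omega> * (r' * t) + q \<omega> * (r * t'))"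
          by (simp add: T_def r_def r'_def t_def t'_def distrib_left mult.assoc)
        ultimately show ?case by simp
      qed
    qed
    finally show ?thesis .
  qed
qed

end

section \<open>The conditional second moment method\<close>

context weighted_recursive_tree
begin

text \<open>
  The conditional expectation, given the weights, of the number of vertices of in-degree at least \<open>k\<close>.
\<close>
definition expected_large :: "nat \<Rightarrow> nat \<Rightarrow> 'a \<Rightarrow> real" where
  "expected_large n k \<omega> = (\<Sum>i=1..n. bern_tail (attach_prob i \<omega>) n k)"

lemma expected_large_weights: "expected_large n k \<in> borel_measurable weights"
  unfolding expected_large_def[abs_def] by (intro borel_measurable_sum tail_weights) auto

lemma expected_large_bounds: "0 \<le> expected_large n k \<omega>" "expected_large n k \<omega> \<le> real n"
proof -
  show "0 \<le> expected_large n k \<omega>"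
    unfolding expected_large_def by (intro sum_nonneg tail_bounds)
  have "expected_large n k \<omega> \<le> (\<Sum>i=1..n. 1)"
    unfolding expected_large_def by (intro sum_mono tail_bounds)
  then show "expected_large n k \<omega> \<le> real n" by simp
qed

lemma sets_deg: "{\<omega> \<in> space M. k \<le> deg n i \<omega>} \<in> sets M"
proof -
  have "{\<omega> \<in> space M. k \<le> deg n i \<omega>} = (\<lambda>\<omega>. of_bool (k \<le> deg n i \<omega>) :: real) -` {1} \<inter> space M"
    by auto
  also have "\<dots> \<in> sets M" by (rule measurable_sets[OF deg_M]) auto
  finally show ?thesis .
qed

lemma integral_sum_sum:
  fixes f :: "'i \<Rightarrow> 'j \<Rightarrow> 'a \<Rightarrow> real"
  assumes "\<And>i j. i \<in> I \<Longrightarrow> j \<in> I' \<Longrightarrow> integrable M (f i j)"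
  shows "(\<integral>\<omega>. (\<Sum>i\<in>I. \<Sum>j\<in>I'. f i j \<omega>) \<partial>M) = (\<Sum>i\<in>I. \<Sum>j\<in>I'. \<integral>\<omega>. f i j \<omega> \<partial>M)"
  using assms by (subst Bochner_Integration.integral_sum)
    (auto intro!: sum.cong Bochner_Integration.integral_sum Bochner_Integration.integrable_sum)

text \<open>
  The second moment estimate: given the weights, the number of vertices with in-degree at least
  \<open>k\<close> has a variance bounded by its mean.
\<close>
lemma prob_no_large_degree:
  assumes c: "0 < c"
  shows "prob {\<omega> \<in> space M. (\<forall>i\<in>{1..n}. deg n i \<omega> < k) \<and> c \<le> expected_large n k \<omega>} \<le> 1 / c"
proof -
  define \<Lambda> where "\<Lambda> = expected_large n k"
  define \<phi> where "\<phi> = (\<lambda>\<omega>. if c \<le> \<Lambda> \<omega> then 1 / (\<Lambda> \<omega>)\<^sup>2 else 0)"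
  define u where "u = (\<lambda>i \<omega>. of_bool (k \<le> deg n i \<omega>) :: real)"
  define t where "t = (\<lambda>i \<omega>. bern_tail (attach_prob i \<omega>) n k)"
  \<comment> \<open>\<open>X\<close> counts the vertices of large in-degree, and \<open>\<phi> * (X - \<Lambda>)\<^sup>2\<close> is \<open>1\<close> on the event in question.\<close>
  define X where "X = (\<lambda>\<omega>. \<Sum>i=1..n. u i \<omega>)"
  let ?E = "{\<omega> \<in> space M. (\<forall>i\<in>{1..n}. deg n i \<omega> < k) \<and> c \<le> \<Lambda> \<omega>}"
  have \<Lambda>w: "\<Lambda> \<in> borel_measurable weights" unfolding \<Lambda>_def by (rule expected_large_weights)
  have \<phi>w: "\<phi> \<in> borel_measurable weights" unfolding \<phi>_def using \<Lambda>w by measurable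
  have \<phi>\<Lambda>w: "(\<lambda>\<omega>. \<phi> \<omega> * \<Lambda> \<omega>) \<in> borel_measurable weights"
    by (intro borel_measurable_times \<phi>w \<Lambda>w)
  have \<Lambda>n: "0 \<le> \<Lambda> \<omega> \<and> \<Lambda> \<omega> \<le> real n" for \<omega>
    by (simp add: \<Lambda>_def expected_large_bounds)
  have \<phi>b: "0 \<le> \<phi> \<omega> \<and> \<phi> \<omega> \<le> 1 / c\<^sup>2" for \<omega>
    using c by (auto simp: \<phi>_def intro!: divide_left_mono power_mono mult_pos_pos)
  have \<phi>\<Lambda>b: "0 \<le> \<phi> \<omega> * \<Lambda> \<omega> \<and> \<phi> \<omega> * \<Lambda> \<omega> \<le> 1 / c" for \<omega>
    using c by (auto simp: \<phi>_def power2_eq_square intro!: divide_left_mono mult_pos_pos)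
  have u01: "0 \<le> u i \<omega> \<and> u i \<omega> \<le> 1" for i \<omega> by (simp add: u_def)
  have t01: "0 \<le> t i \<omega> \<and> t i \<omega> \<le> 1" for i \<omega> by (simp add: t_def tail_bounds)
  have uM [measurable]: "u i \<in> borel_measurable M" for i unfolding u_def by (rule deg_M)
  have tM: "t i \<in> borel_measurable M" if "i \<in> {1..n}" for i
    unfolding t_def using that by (intro weights_M tail_weights) auto
  have \<Lambda>M [measurable]: "\<Lambda> \<in> borel_measurable M" and \<phi>M [measurable]: "\<phi> \<in> borel_measurable M"
    using weights_M \<Lambda>w \<phi>w by auto
  have \<Lambda>t: "\<Lambda> \<omega> = (\<Sum>i=1..n. t i \<omega>)" for \<omega> by (simp add: \<Lambda>_def expected_large_def t_def)
  have int: "integrable M (\<lambda>\<omega>. \<phi> \<omega> * r \<omega>)"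
    if "r \<in> borel_measurable M" "\<And>\<omega>. \<bar>r \<omega>\<bar> \<le> B" for r B
  proof (rule integrable_bdd[where B = "1 / c\<^sup>2 * B"])
    show "\<bar>\<phi> \<omega> * r \<omega>\<bar> \<le> 1 / c\<^sup>2 * B" for \<omega>
      unfolding abs_mult using \<phi>b[of \<omega>] that(2)[of \<omega>] by (intro mult_mono) auto
  qed (use that in measurable)
  have XM [measurable]: "X \<in> borel_measurable M" unfolding X_def by measurable
  have X0: "0 \<le> X \<omega> \<and> X \<omega> \<le> real n" for \<omega>
    using sum_mono[of "{1..n}" "\<lambda>i. u i \<omega>" "\<lambda>_. 1"] u01 by (auto simp: X_def intro!: sum_nonneg)
  have prod_n: "\<bar>a * b\<bar> \<le> real n * real n"
    if "0 \<le> a \<and> a \<le> real n" "0 \<le> b \<and> b \<le> real n" for a b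
    unfolding abs_mult using that by (intro mult_mono) auto
  have EM: "?E \<in> sets M"
  proof -
    have "?E = (\<Inter>i\<in>{1..n}. space M - {\<omega> \<in> space M. k \<le> deg n i \<omega>}) \<inter> {\<omega> \<in> space M. c \<le> \<Lambda> \<omega>}"
      if "n \<noteq> 0" using that by (auto simp: not_le)
    moreover have "?E = {\<omega> \<in> space M. c \<le> \<Lambda> \<omega>}" if "n = 0" using that by auto
    ultimately show ?thesis using sets_deg by (cases "n = 0") (auto intro!: sets.Int sets.finite_INT sets.Diff)
  qed
  have EX2: "(\<integral>\<omega>. \<phi> \<omega> * (X \<omega> * X \<omega>) \<partial>M) \<le> (\<integral>\<omega>. \<phi> \<omega> * (\<Lambda> \<omega> * \<Lambda> \<omega>) \<partial>M) + (\<integral>\<omega>. \<phi> \<omega> * \<Lambda> \<omega> \<partial>M)"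
  proof -
    have "(\<integral>\<omega>. \<phi> \<omega> * (X \<omega> * X \<omega>) \<partial>M) = (\<integral>\<omega>. (\<Sum>i=1..n. \<Sum>j=1..n. \<phi> \<omega> * (u i \<omega> * u j \<omega>)) \<partial>M)"
      unfolding X_def sum_product by (simp only: sum_distrib_left)
    also have "\<dots> = (\<Sum>i=1..n. \<Sum>j=1..n. (\<integral>\<omega>. \<phi> \<omega> * (u i \<omega> * u j \<omega>) \<partial>M))"
    proof -
      have "integrable M (\<lambda>\<omega>. \<phi> \<omega> * (u i \<omega> * u j \<omega>))" for i j
        by (intro int[of _ 1] borel_measurable_times uM) (simp add: u_def)
      then show ?thesis by (intro integral_sum_sum)
    qed
    also have "\<dots> \<le> (\<Sum>i=1..n. \<Sum>j=1..n. (\<integral>\<omega>. \<phi> \<omega> * (t i \<omega> * t j \<omega> + (if i = j then t i \<omega> else 0)) \<partial>M))"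
    proof (intro sum_mono)
      fix i j assume ij: "i \<in> {1..n}" "j \<in> {1..n}"
      show "(\<integral>\<omega>. \<phi> \<omega> * (u i \<omega> * u j \<omega>) \<partial>M) \<le> (\<integral>\<omega>. \<phi> \<omega> * (t i \<omega> * t j \<omega> + (if i = j then t i \<omega> else 0)) \<partial>M)"
      proof (cases "i = j")
        case False
        then show ?thesis
          using expectation_tail_pair[OF \<phi>w \<phi>b, where n = n and i = i and j = j and a = k and b = k] ij by (simp add: u_def t_def)
      next
        case True
        have "(\<integral>\<omega>. \<phi> \<omega> * (u i \<omega> * u j \<omega>) \<partial>M) = (\<integral>\<omega>. \<phi> \<omega> * u i \<omega> \<partial>M)"
          using True by (intro Bochner_Integration.integral_cong) (auto simp: u_def)
        also have "\<dots> = (\<integral>\<omega>. \<phi> \<omega> * t i \<omega> \<partial>M)"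
          unfolding u_def t_def using ij \<phi>b by (intro expectation_tail[OF \<phi>w, of "1 / c\<^sup>2"]) auto
        also have "\<dots> \<le> (\<integral>\<omega>. \<phi> \<omega> * (t i \<omega> * t j \<omega> + (if i = j then t i \<omega> else 0)) \<partial>M)"
        proof (rule integral_mono)
          show "integrable M (\<lambda>\<omega>. \<phi> \<omega> * t i \<omega>)"
            using t01 ij tM by (intro int[of _ 1]) auto
          show "integrable M (\<lambda>\<omega>. \<phi> \<omega> * (t i \<omega> * t j \<omega> + (if i = j then t i \<omega> else 0)))"
          proof (rule int[of _ 2])
            show "\<bar>t i \<omega> * t j \<omega> + (if i = j then t i \<omega> else 0)\<bar> \<le> 2" for \<omega>
              using t01[of i \<omega>] t01[of j \<omega>] mult_le_one[of "t i \<omega>" "t j \<omega>"] by auto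
          qed (use ij tM in auto)
          show "\<phi> \<omega> * t i \<omega> \<le> \<phi> \<omega> * (t i \<omega> * t j \<omega> + (if i = j then t i \<omega> else 0))" for \<omega>
            using True t01 \<phi>b by (intro mult_left_mono) auto
        qed
        finally show ?thesis .
      qed
    qed
    also have "\<dots> = (\<integral>\<omega>. (\<Sum>i=1..n. \<Sum>j=1..n. \<phi> \<omega> * (t i \<omega> * t j \<omega> + (if i = j then t i \<omega> else 0))) \<partial>M)"
    proof -
      have "integrable M (\<lambda>\<omega>. \<phi> \<omega> * (t i \<omega> * t j \<omega> + (if i = j then t i \<omega> else 0)))"
        if "i \<in> {1..n}" "j \<in> {1..n}" for i j
      proof (rule int[of _ 2])
        show "\<bar>t i \<omega> * t j \<omega> + (if i = j then t i \<omega> else 0)\<bar> \<le> 2" for \<omega>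
          using t01[of i \<omega>] t01[of j \<omega>] mult_le_one[of "t i \<omega>" "t j \<omega>"] by auto
      qed (use that tM in auto)
      then show ?thesis by (intro integral_sum_sum[symmetric])
    qed
    also have "\<dots> = (\<integral>\<omega>. \<phi> \<omega> * (\<Lambda> \<omega> * \<Lambda> \<omega>) + \<phi> \<omega> * \<Lambda> \<omega> \<partial>M)"
    proof (intro Bochner_Integration.integral_cong refl)
      fix \<omega>
      have "(\<Sum>i=1..n. \<Sum>j=1..n. (t i \<omega> * t j \<omega> + (if i = j then t i \<omega> else 0))) = \<Lambda> \<omega> * \<Lambda> \<omega> + \<Lambda> \<omega>"
        by (simp add: sum.distrib \<Lambda>t sum_product)
      then show "(\<Sum>i=1..n. \<Sum>j=1..n. \<phi> \<omega> * (t i \<omega> * t j \<omega> + (if i = j then t i \<omega> else 0)))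
          = \<phi> \<omega> * (\<Lambda> \<omega> * \<Lambda> \<omega>) + \<phi> \<omega> * \<Lambda> \<omega>"
        by (simp only: sum_distrib_left[symmetric] distrib_left[symmetric])
    qed
    also have "\<dots> = (\<integral>\<omega>. \<phi> \<omega> * (\<Lambda> \<omega> * \<Lambda> \<omega>) \<partial>M) + (\<integral>\<omega>. \<phi> \<omega> * \<Lambda> \<omega> \<partial>M)"
      using \<Lambda>n by (intro Bochner_Integration.integral_add int[of _ "real n * real n"]
          int[of _ "real n"] prod_n) auto
    finally show ?thesis .
  qed
  have EX\<Lambda>: "(\<integral>\<omega>. \<phi> \<omega> * (\<Lambda> \<omega> * X \<omega>) \<partial>M) = (\<integral>\<omega>. \<phi> \<omega> * (\<Lambda> \<omega> * \<Lambda> \<omega>) \<partial>M)"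
  proof -
    have i: "integrable M (\<lambda>\<omega>. (\<phi> \<omega> * \<Lambda> \<omega>) * u i \<omega>)" "i \<in> {1..n} \<Longrightarrow> integrable M (\<lambda>\<omega>. (\<phi> \<omega> * \<Lambda> \<omega>) * t i \<omega>)" for i
      using \<phi>\<Lambda>b u01 t01 tM by (auto intro!: integrable_bdd_mult[where B = "1 / c"])
    have "(\<integral>\<omega>. \<phi> \<omega> * (\<Lambda> \<omega> * X \<omega>) \<partial>M) = (\<integral>\<omega>. (\<Sum>i=1..n. (\<phi> \<omega> * \<Lambda> \<omega>) * u i \<omega>) \<partial>M)"
      by (intro Bochner_Integration.integral_cong) (simp_all add: X_def sum_distrib_left mult.assoc)
    also have "\<dots> = (\<Sum>i=1..n. (\<integral>\<omega>. (\<phi> \<omega> * \<Lambda> \<omega>) * u i \<omega> \<partial>M))"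
      by (intro Bochner_Integration.integral_sum i)
    also have "\<dots> = (\<Sum>i=1..n. (\<integral>\<omega>. (\<phi> \<omega> * \<Lambda> \<omega>) * t i \<omega> \<partial>M))"
      unfolding u_def t_def using \<phi>\<Lambda>b
      by (intro sum.cong refl expectation_tail[OF \<phi>\<Lambda>w, of "1 / c"]) auto
    also have "\<dots> = (\<integral>\<omega>. (\<Sum>i=1..n. (\<phi> \<omega> * \<Lambda> \<omega>) * t i \<omega>) \<partial>M)"
      by (intro Bochner_Integration.integral_sum[symmetric] i)
    also have "\<dots> = (\<integral>\<omega>. \<phi> \<omega> * (\<Lambda> \<omega> * \<Lambda> \<omega>) \<partial>M)"
      by (intro Bochner_Integration.integral_cong)
         (simp_all add: \<Lambda>t sum_distrib_left sum_distrib_right mult.assoc)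
    finally show ?thesis .
  qed
  have i1: "integrable M (\<lambda>\<omega>. \<phi> \<omega> * (X \<omega> * X \<omega>))" "integrable M (\<lambda>\<omega>. \<phi> \<omega> * (\<Lambda> \<omega> * X \<omega>))"
      "integrable M (\<lambda>\<omega>. \<phi> \<omega> * (\<Lambda> \<omega> * \<Lambda> \<omega>))"
    using X0 \<Lambda>n by (auto intro!: int[of _ "real n * real n"] prod_n)
  have "prob ?E = (\<integral>\<omega>. indicator ?E \<omega> \<partial>M)" using EM by simp
  also have "\<dots> \<le> (\<integral>\<omega>. \<phi> \<omega> * (X \<omega> * X \<omega>) - 2 * (\<phi> \<omega> * (\<Lambda> \<omega> * X \<omega>)) + \<phi> \<omega> * (\<Lambda> \<omega> * \<Lambda> \<omega>) \<partial>M)"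
  proof (rule integral_mono)
    show "integrable M (indicator ?E :: 'a \<Rightarrow> real)" using EM by (simp add: emeasure_eq_measure)
    show "integrable M (\<lambda>\<omega>. \<phi> \<omega> * (X \<omega> * X \<omega>) - 2 * (\<phi> \<omega> * (\<Lambda> \<omega> * X \<omega>)) + \<phi> \<omega> * (\<Lambda> \<omega> * \<Lambda> \<omega>))"
      using i1 by simp
    show "indicator ?E \<omega> \<le> \<phi> \<omega> * (X \<omega> * X \<omega>) - 2 * (\<phi> \<omega> * (\<Lambda> \<omega> * X \<omega>)) + \<phi> \<omega> * (\<Lambda> \<omega> * \<Lambda> \<omega>)"
      if "\<omega> \<in> space M" for \<omega>
    proof -
      have sq: "\<phi> \<omega> * (X \<omega> * X \<omega>) - 2 * (\<phi> \<omega> * (\<Lambda> \<omega> * X \<omega>)) + \<phi> \<omega> * (\<Lambda> \<omega> * \<Lambda> \<omega>)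
          = \<phi> \<omega> * (X \<omega> - \<Lambda> \<omega>)\<^sup>2"
        by (simp add: power2_eq_square algebra_simps)
      show ?thesis
      proof (cases "\<omega> \<in> ?E")
        case True
        then have "X \<omega> = 0" by (auto simp: X_def u_def intro!: sum.neutral)
        then show ?thesis unfolding sq using True c by (simp add: \<phi>_def)
      next
        case False
        have "0 \<le> \<phi> \<omega> * (X \<omega> - \<Lambda> \<omega>)\<^sup>2" using \<phi>b by simp
        then show ?thesis unfolding sq indicator_simps(2)[OF False] .
      qed
    qed
  qed
  also have "\<dots> = (\<integral>\<omega>. \<phi> \<omega> * (X \<omega> * X \<omega>) \<partial>M) - 2 * (\<integral>\<omega>. \<phi> \<omega> * (\<Lambda> \<omega> * X \<omega>) \<partial>M)
      + (\<integral>\<omega>. \<phi> \<omega> * (\<Lambda> \<omega> * \<Lambda> \<omega>) \<partial>M)"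
    using i1 by simp
  also have "\<dots> \<le> (\<integral>\<omega>. \<phi> \<omega> * \<Lambda> \<omega> \<partial>M)" using EX2 EX\<Lambda> by simp
  also have "\<dots> \<le> (\<integral>\<omega>. 1 / c \<partial>M)"
    using \<phi>\<Lambda>b \<Lambda>n by (intro integral_mono int[of _ "real n"]) auto
  also have "\<dots> = 1 / c" by (simp add: prob_space)
  finally show ?thesis by (simp add: \<Lambda>_def)
qed

end

section \<open>Weights bounded by one: first and second moment bounds\<close>

text \<open>
  A weighted recursive tree with weights in \<open>(0,1]\<close>.
\<close>
locale bounded_weighted_recursive_tree = weighted_recursive_tree +
  assumes law_le_1: "AE x in \<mu>. x \<le> 1"
begin

definition mean_W :: real where "mean_W = (\<integral>x. x \<partial>\<mu>)"

text \<open>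
  The event that the sums of the first \<open>l\<close> weights, for \<open>J \<le> l < n\<close>, are within \<open>s l\<close> of their means.
\<close>
definition typical :: "(nat \<Rightarrow> real) \<Rightarrow> nat \<Rightarrow> nat \<Rightarrow> 'a set" where
  "typical s J n = {\<omega> \<in> space M. \<forall>l\<in>{J..<n}. \<bar>weight_sum l \<omega> - mean_W * real l\<bar> \<le> s l}"

lemma prob_space_law: "prob_space \<mu>"
  using law by (simp add: real_distribution_def)

lemma sets_law [measurable_cong]: "sets \<mu> = sets borel"
  using law by (simp add: real_distribution_def real_distribution_axioms_def)

lemma space_law [simp]: "space \<mu> = UNIV"
  using sets_eq_imp_space_eq[OF sets_law] by simp

lemma law_bounds: "AE x in \<mu>. 0 < x \<and> x \<le> 1"
  using law_pos law_le_1 by eventually_elim simp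

lemma law_integrable:
  assumes "f \<in> borel_measurable borel" "\<And>x. 0 < x \<Longrightarrow> x \<le> 1 \<Longrightarrow> \<bar>f x\<bar> \<le> (B::real)"
  shows "integrable \<mu> f"
proof -
  interpret \<mu>: prob_space \<mu> by (rule prob_space_law)
  show ?thesis
  proof (rule \<mu>.integrable_const_bound[where B = B])
    show "AE x in \<mu>. norm (f x) \<le> B"
      using law_bounds by eventually_elim (auto intro: assms(2))
    show "f \<in> borel_measurable \<mu>"
      using assms(1) by (simp cong: measurable_cong_sets add: sets_law)
  qed
qed

lemma integral_law:
  assumes "1 \<le> i" "f \<in> borel_measurable borel"
  shows "(\<integral>\<omega>. f (W i \<omega>) \<partial>M) = (\<integral>x. (f x :: real) \<partial>\<mu>)"
  using assms W_borel by (subst weights_law[symmetric, of i]) (auto simp: integral_distr)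

lemma mean_W_pos: "0 < mean_W"
proof -
  interpret \<mu>: prob_space \<mu> by (rule prob_space_law)
  have "integrable \<mu> (\<lambda>x. x)" by (rule law_integrable[of _ 1]) auto
  then have "0 \<le> mean_W" "mean_W = 0 \<longleftrightarrow> (AE x in \<mu>. x = 0)"
    unfolding mean_W_def using law_pos
    by (auto intro!: integral_nonneg_AE integral_nonneg_eq_0_iff_AE elim: eventually_mono)
  moreover have "\<not> (AE x in \<mu>. x = 0)"
  proof
    assume "AE x in \<mu>. x = 0"
    with law_pos have "AE x in \<mu>. False" by eventually_elim auto
    then show False by simp
  qed
  ultimately show ?thesis by simp
qed

lemma AE_weights_bounds: "AE \<omega> in M. \<forall>i\<ge>1. 0 < W i \<omega> \<and> W i \<omega> \<le> 1"
  using AE_weight[OF _ law_bounds] by (subst AE_all_countable) auto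

lemma typical_weights: "(\<lambda>\<omega>. indicator (typical s J n) \<omega> :: real) \<in> borel_measurable weights"
  "typical s J n \<in> sets M"
proof -
  note [measurable] = weight_sum_weights
  have "{\<omega> \<in> space weights. \<forall>l\<in>{J..<n}. \<bar>weight_sum l \<omega> - mean_W * real l\<bar> \<le> s l} \<in> sets weights"
    by measurable
  then have "typical s J n \<in> sets weights" by (simp add: typical_def)
  then show "(\<lambda>\<omega>. indicator (typical s J n) \<omega> :: real) \<in> borel_measurable weights" by simp
  show "typical s J n \<in> sets M"
    using \<open>typical s J n \<in> sets weights\<close> subalgebra_wrt_history[of 0] by (auto simp: subalgebra_def)
qed

text \<open>
  Hoeffding's inequality and a union bound.
\<close>
lemma prob_not_typical:
  assumes J: "1 \<le> J" and s: "\<And>l. 0 \<le> s l"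
  shows "prob (space M - typical s J n) \<le> (\<Sum>l=J..<n. 2 * exp (- 2 * (s l)\<^sup>2 / real l))"
proof -
  note [measurable] = weights_M[OF weight_sum_weights]
  have "prob (space M - typical s J n)
      \<le> prob (\<Union>l\<in>{J..<n}. {\<omega> \<in> space M. s l \<le> \<bar>weight_sum l \<omega> - mean_W * real l\<bar>})"
    by (intro finite_measure_mono) (auto simp: typical_def)
  also have "\<dots> \<le> (\<Sum>l\<in>{J..<n}. prob {\<omega> \<in> space M. s l \<le> \<bar>weight_sum l \<omega> - mean_W * real l\<bar>})"
    by (intro finite_measure_subadditive_finite) auto
  also have "\<dots> \<le> (\<Sum>l=J..<n. 2 * exp (- 2 * (s l)\<^sup>2 / real l))"
  proof (intro sum_mono)
    fix l assume l: "l \<in> {J..<n}"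
    have sum_expectation: "(\<Sum>i\<in>{1..l}. expectation (W i)) = mean_W * real l"
      using integral_law[of _ "\<lambda>x. x"] by (simp add: mean_W_def)
    interpret Hoeffding_ineq M "{1..l}" W "\<lambda>_. 0" "\<lambda>_. 1" "\<Sum>i\<in>{1..l}. expectation (W i)"
    proof unfold_locales
      show "indep_vars (\<lambda>_. borel) W {1..l}"
        by (rule indep_vars_subset[OF weights_indep]) auto
      show "AE \<omega> in M. W i \<omega> \<in> {0..1}" if "i \<in> {1..l}" for i
        using AE_weights_bounds that by (auto intro: less_imp_le elim!: eventually_mono)
    qed auto
    have "prob {\<omega> \<in> space M. s l \<le> \<bar>(\<Sum>i\<in>{1..l}. W i \<omega>) - (\<Sum>i\<in>{1..l}. expectation (W i))\<bar>}
        \<le> 2 * exp (- 2 * (s l)\<^sup>2 / (\<Sum>i\<in>{1..l}. (1 - 0)\<^sup>2))"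
      using s l J by (intro Hoeffding_ineq_abs_ge) auto
    then show "prob {\<omega> \<in> space M. s l \<le> \<bar>weight_sum l \<omega> - mean_W * real l\<bar>} \<le> 2 * exp (- 2 * (s l)\<^sup>2 / real l)"
      unfolding sum_expectation by (simp add: weight_sum_def)
  qed
  finally show ?thesis .
qed

lemma attach_prob_le_wt_prob:
  assumes \<omega>: "\<omega> \<in> typical s J n" and W: "\<forall>i\<ge>1. 0 < W i \<omega> \<and> W i \<omega> \<le> 1" and i: "1 \<le> i" and l: "l < n"
    and d: "1 \<le> mean_W * real l - s l \<or> l < J"
  shows "attach_prob i \<omega> l \<le> wt_prob J 1 (\<lambda>l. mean_W * real l - s l) (W i \<omega>) i l"
proof (cases "J \<le> l \<and> i \<le> l")
  case True
  then have t: "mean_W * real l - s l \<le> weight_sum l \<omega>" using \<omega> l by (force simp: typical_def)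
  have w: "0 < W i \<omega>" using W i by simp
  have d': "1 \<le> mean_W * real l - s l" using d True by simp
  have "0 \<le> W i \<omega> / weight_sum l \<omega>" using w t d' by simp
  moreover have "W i \<omega> / weight_sum l \<omega> \<le> W i \<omega> / (mean_W * real l - s l)"
    using w t d' by (intro frac_le) auto
  ultimately show ?thesis using True by (simp add: attach_prob_def wt_prob_def)
qed (auto simp: wt_prob_def attach_prob_bounds, simp add: attach_prob_def)

lemma wt_prob_le_attach_prob:
  assumes \<omega>: "\<omega> \<in> typical s J n" and W: "\<forall>i\<ge>1. 0 < W i \<omega> \<and> W i \<omega> \<le> 1" and i: "1 \<le> i" and l: "l < n"
    and d: "1 \<le> mean_W * real l + s l \<or> l < J"
  shows "wt_prob J 0 (\<lambda>l. mean_W * real l + s l) (W i \<omega>) i l \<le> attach_prob i \<omega> l"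
proof (cases "J \<le> l \<and> i \<le> l")
  case True
  then have t: "weight_sum l \<omega> \<le> mean_W * real l + s l" using \<omega> l by (force simp: typical_def)
  have "W i \<omega> \<le> weight_sum l \<omega>" unfolding weight_sum_def
    using i True W by (intro member_le_sum) (auto intro: less_imp_le)
  moreover have w: "0 < W i \<omega>" "W i \<omega> \<le> 1" using W i by auto
  ultimately have "W i \<omega> / (mean_W * real l + s l) \<le> W i \<omega> / weight_sum l \<omega>"
    using t by (intro frac_le) auto
  moreover have "W i \<omega> / (mean_W * real l + s l) \<le> 1"
    using w d True by (simp add: divide_le_eq_1)
  ultimately show ?thesis using True by (auto simp: attach_prob_def wt_prob_def)
qed (auto simp: wt_prob_def attach_prob_bounds)

lemma borel_measurable_wt_tail [measurable]:
  "(\<lambda>w. bern_tail (wt_prob J e d w i) n k) \<in> borel_measurable borel"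
  by (rule borel_measurable_bern_tail) (simp add: wt_prob_def)

text \<open>
  The first moment bound.  On the typical event the weight sums may be replaced by the deterministic
  lower bounds \<open>mean_W * l - s l\<close>; the bound then depends on the weights only through the weight of
  the vertex considered, which is integrated out.
\<close>
lemma prob_large_degree:
  fixes s x :: "nat \<Rightarrow> real"
  assumes J: "1 \<le> J" "J \<le> n" "J \<le> k"
    and d: "\<And>l. J \<le> l \<Longrightarrow> 1 \<le> mean_W * real l - s l"
    and x: "\<And>l. J \<le> l \<Longrightarrow> 0 \<le> x l"
    and growth: "\<And>l. J \<le> l \<Longrightarrow>
      real l * (1 + mean_W / (mean_W * real l - s l)) \<le> (real l + 1) * exp (x l)"
  shows "prob {\<omega> \<in> space M. \<exists>i\<in>{1..n}. k \<le> deg n i \<omega>} \<le> prob (space M - typical s J n)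
    + real n * exp (\<Sum>l=J..<n. x l) * (\<integral>w. (w / (mean_W + w)) ^ (k - J) \<partial>\<mu>)"
proof -
  define A where "A = typical s J n"
  define d where "d = (\<lambda>l. mean_W * real l - s l)"
  define R where "R = (\<lambda>i w. bern_tail (wt_prob J 1 d w i) n k)"
  have AM [measurable]: "A \<in> sets M" unfolding A_def by (rule typical_weights)
  have d1: "1 \<le> d l" if "J \<le> l" for l using assms(4)[OF that] by (simp add: d_def)
  have RM [measurable]: "R i \<in> borel_measurable borel" for i unfolding R_def by measurable
  have R01: "0 \<le> R i w \<and> R i w \<le> 1" if "0 < w" "w \<le> 1" for i w
    unfolding R_def using that d1
    by (auto intro!: bern_tail_bounds wt_prob_bounds)
  have Rint: "integrable \<mu> (R i)" for i
    using R01 by (intro law_integrable[of _ 1]) auto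
  have "prob {\<omega> \<in> space M. \<exists>i\<in>{1..n}. k \<le> deg n i \<omega>}
      \<le> prob ((space M - A) \<union> (\<Union>i\<in>{1..n}. A \<inter> {\<omega> \<in> space M. k \<le> deg n i \<omega>}))"
    using sets_deg by (intro finite_measure_mono) auto
  also have "\<dots> \<le> prob (space M - A) + prob (\<Union>i\<in>{1..n}. A \<inter> {\<omega> \<in> space M. k \<le> deg n i \<omega>})"
    using sets_deg by (intro measure_Un_le) auto
  also have "prob (\<Union>i\<in>{1..n}. A \<inter> {\<omega> \<in> space M. k \<le> deg n i \<omega>})
      \<le> (\<Sum>i\<in>{1..n}. prob (A \<inter> {\<omega> \<in> space M. k \<le> deg n i \<omega>}))"
    using sets_deg by (intro finite_measure_subadditive_finite) auto
  also have "\<dots> \<le> (\<Sum>i\<in>{1..n}. \<integral>w. R i w \<partial>\<mu>)"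
  proof (intro sum_mono)
    fix i assume i: "i \<in> {1..n}"
    have "prob (A \<inter> {\<omega> \<in> space M. k \<le> deg n i \<omega>})
        = (\<integral>\<omega>. indicator A \<omega> * of_bool (k \<le> deg n i \<omega>) \<partial>M)"
    proof -
      have "prob (A \<inter> {\<omega> \<in> space M. k \<le> deg n i \<omega>})
          = (\<integral>\<omega>. indicator (A \<inter> {\<omega> \<in> space M. k \<le> deg n i \<omega>}) \<omega> \<partial>M)"
        using sets_deg by simp
      also have "\<dots> = (\<integral>\<omega>. indicator A \<omega> * of_bool (k \<le> deg n i \<omega>) \<partial>M)"
        by (intro Bochner_Integration.integral_cong) (auto simp: indicator_def)
      finally show ?thesis .
    qed
    also have "\<dots> = (\<integral>\<omega>. indicator A \<omega> * bern_tail (attach_prob i \<omega>) n k \<partial>M)"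
      unfolding A_def using i
      by (intro expectation_tail[where B = 1] typical_weights) (auto simp: indicator_def)
    also have "\<dots> \<le> (\<integral>\<omega>. R i (W i \<omega>) \<partial>M)"
    proof (rule integral_mono_AE)
      have tM: "(\<lambda>\<omega>. bern_tail (attach_prob i \<omega>) n k) \<in> borel_measurable M"
        using i by (intro weights_M tail_weights) auto
      show "integrable M (\<lambda>\<omega>. indicator A \<omega> * bern_tail (attach_prob i \<omega>) n k)"
        using tM by (intro integrable_bdd_mult[where B = 1]) (auto simp: tail_bounds indicator_def)
      have [measurable]: "W i \<in> borel_measurable M" using i W_borel by simp
      show "integrable M (\<lambda>\<omega>. R i (W i \<omega>))"
      proof (rule integrable_const_bound[where B = 1])
        show "AE \<omega> in M. norm (R i (W i \<omega>)) \<le> 1"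
          using AE_weights_bounds by eventually_elim (use R01 i in auto)
      qed measurable
      show "AE \<omega> in M. indicator A \<omega> * bern_tail (attach_prob i \<omega>) n k \<le> R i (W i \<omega>)"
        using AE_weights_bounds
      proof eventually_elim
        case (elim \<omega>)
        then have w: "0 < W i \<omega>" "W i \<omega> \<le> 1" using i by auto
        show ?case
        proof (cases "\<omega> \<in> A")
          case True
          have "bern_tail (attach_prob i \<omega>) n k \<le> R i (W i \<omega>)"
            unfolding R_def
          proof (rule bern_tail_mono)
            fix l assume "l < n"
            then have "attach_prob i \<omega> l \<le> wt_prob J 1 d (W i \<omega>) i l"
              unfolding d_def using True elim i assms(4)[of l]
              by (intro attach_prob_le_wt_prob[of \<omega> s J n]) (auto simp: A_def not_le)
            moreover have "wt_prob J 1 d (W i \<omega>) i l \<le> 1"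
              using w d1 by (intro wt_prob_bounds) auto
            ultimately show "0 \<le> attach_prob i \<omega> l \<and> attach_prob i \<omega> l \<le> wt_prob J 1 d (W i \<omega>) i l
                \<and> wt_prob J 1 d (W i \<omega>) i l \<le> 1"
              using attach_prob_bounds by auto
          qed
          with True show ?thesis by simp
        qed (use R01[OF w] in simp)
      qed
    qed
    also have "\<dots> = (\<integral>w. R i w \<partial>\<mu>)" using i by (intro integral_law) auto
    finally show "prob (A \<inter> {\<omega> \<in> space M. k \<le> deg n i \<omega>}) \<le> (\<integral>w. R i w \<partial>\<mu>)" .
  qed
  also have "\<dots> = (\<integral>w. (\<Sum>i\<in>{1..n}. R i w) \<partial>\<mu>)"
    using Rint by (simp add: Bochner_Integration.integral_sum)
  also have "\<dots> \<le> (\<integral>w. real n * exp (\<Sum>l=J..<n. x l) * (w / (mean_W + w)) ^ (k - J) \<partial>\<mu>)"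
  proof (rule integral_mono_AE)
    show "integrable \<mu> (\<lambda>w. \<Sum>i\<in>{1..n}. R i w)" using Rint by auto
    have "integrable \<mu> (\<lambda>w. (w / (mean_W + w)) ^ (k - J))"
      using mean_W_pos by (intro law_integrable[of _ 1]) (auto intro!: power_le_one)
    then show "integrable \<mu> (\<lambda>w. real n * exp (\<Sum>l=J..<n. x l) * (w / (mean_W + w)) ^ (k - J))"
      by simp
    show "AE w in \<mu>. (\<Sum>i\<in>{1..n}. R i w) \<le> real n * exp (\<Sum>l=J..<n. x l) * (w / (mean_W + w)) ^ (k - J)"
      using law_bounds
    proof eventually_elim
      case (elim w)
      then show ?case unfolding R_def
        using mean_W_pos J d1 x growth by (intro sum_bern_tail_upper) (auto simp: d_def)
    qed
  qed
  finally show ?thesis by (simp add: A_def)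
qed

lemma exp_minus_le:
  assumes "0 \<le> r" "r \<le> 1"
  shows "exp (- r) \<le> 1 - r / (2::real)"
proof -
  have "(1 - r / 2) * (1 + r) - 1 = (r - r * r) / 2" by (simp add: field_simps)
  moreover have "r * r \<le> r * 1" using assms by (intro mult_left_mono) auto
  ultimately have "1 \<le> (1 - r / 2) * (1 + r)" by simp
  also have "\<dots> \<le> (1 - r / 2) * exp r" using assms by (intro mult_left_mono) auto
  finally have "1 / exp r \<le> 1 - r / 2" by (simp add: divide_le_eq)
  then show ?thesis by (simp add: exp_minus inverse_eq_divide)
qed

text \<open>
  A sum of independent functions with values in \<open>{0..1}\<close> is unlikely to be below a quarter of its
  expectation, by an exponential moment.
\<close>
lemma prob_small_sum:
  fixes R :: "nat \<Rightarrow> real \<Rightarrow> real"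
  assumes R [measurable]: "\<And>i. R i \<in> borel_measurable borel"
    and R01: "\<And>i w. 0 < w \<Longrightarrow> w \<le> 1 \<Longrightarrow> 0 \<le> R i w \<and> R i w \<le> 1"
    and E: "E = (\<Sum>i\<in>{1..n}. \<integral>w. R i w \<partial>\<mu>)"
  shows "prob {\<omega> \<in> space M. (\<Sum>i\<in>{1..n}. R i (W i \<omega>)) \<le> E / 4} \<le> exp (- E / 4)"
proof -
  let ?Y = "\<lambda>\<omega>. \<Sum>i\<in>{1..n}. R i (W i \<omega>)"
  interpret \<mu>: prob_space \<mu> by (rule prob_space_law)
  have Wm [measurable]: "i \<in> {1..n} \<Longrightarrow> W i \<in> borel_measurable M" for i using W_borel by simp
  have indep: "indep_vars (\<lambda>_. borel) (\<lambda>i \<omega>. exp (- R i (W i \<omega>))) {1..n}"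
    by (rule indep_vars_compose2[OF indep_vars_subset[OF weights_indep]]) auto
  have int: "integrable M (\<lambda>\<omega>. exp (- R i (W i \<omega>)))" if "i \<in> {1..n}" for i
  proof (rule integrable_const_bound[where B = 1])
    show "AE \<omega> in M. norm (exp (- R i (W i \<omega>))) \<le> 1"
      using AE_weights_bounds by eventually_elim (use R01 that in auto)
  qed (use that in measurable)
  have prod: "(\<integral>\<omega>. (\<Prod>i\<in>{1..n}. exp (- R i (W i \<omega>))) \<partial>M) = (\<Prod>i\<in>{1..n}. \<integral>\<omega>. exp (- R i (W i \<omega>)) \<partial>M)"
    by (rule indep_vars_lebesgue_integral[OF _ indep int]) auto
  have prod_int: "integrable M (\<lambda>\<omega>. \<Prod>i\<in>{1..n}. exp (- R i (W i \<omega>)))"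
    by (rule indep_vars_integrable[OF _ indep int]) auto
  have eY: "exp (- ?Y \<omega>) = (\<Prod>i\<in>{1..n}. exp (- R i (W i \<omega>)))" for \<omega>
    by (simp add: exp_sum flip: sum_negf)
  have "{\<omega> \<in> space M. ?Y \<omega> \<le> E / 4} = {\<omega> \<in> space M. exp (- E / 4) \<le> exp (- ?Y \<omega>)}"
    by auto
  moreover have "prob {\<omega> \<in> space M. exp (- E / 4) \<le> exp (- ?Y \<omega>)} \<le> (\<integral>\<omega>. exp (- ?Y \<omega>) \<partial>M) / exp (- E / 4)"
    using prod_int unfolding eY[symmetric]
    by (intro integral_Markov_inequality_measure[where A = "{}"]) auto
  ultimately have "prob {\<omega> \<in> space M. ?Y \<omega> \<le> E / 4} \<le> (\<integral>\<omega>. exp (- ?Y \<omega>) \<partial>M) / exp (- E / 4)"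
    by simp
  also have "(\<integral>\<omega>. exp (- ?Y \<omega>) \<partial>M) = (\<Prod>i\<in>{1..n}. \<integral>\<omega>. exp (- R i (W i \<omega>)) \<partial>M)"
    unfolding eY by (rule prod)
  also have "\<dots> \<le> (\<Prod>i\<in>{1..n}. exp (- (\<integral>w. R i w \<partial>\<mu>) / 2))"
  proof (intro prod_mono conjI)
    fix i assume i: "i \<in> {1..n}"
    show "0 \<le> (\<integral>\<omega>. exp (- R i (W i \<omega>)) \<partial>M)" by simp
    have iR: "integrable \<mu> (R i)" using R01 by (intro law_integrable[of _ 1]) auto
    have "(\<integral>\<omega>. exp (- R i (W i \<omega>)) \<partial>M) = (\<integral>w. exp (- R i w) \<partial>\<mu>)"
      using i by (intro integral_law) auto
    also have "\<dots> \<le> (\<integral>w. 1 - R i w / 2 \<partial>\<mu>)"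
    proof (rule integral_mono_AE)
      show "integrable \<mu> (\<lambda>w. exp (- R i w))" using R01 by (intro law_integrable[of _ 1]) auto
      show "integrable \<mu> (\<lambda>w. 1 - R i w / 2)" using iR by simp
      show "AE w in \<mu>. exp (- R i w) \<le> 1 - R i w / 2"
        using law_bounds by eventually_elim (use R01 in \<open>auto intro: exp_minus_le\<close>)
    qed
    also have "\<dots> = 1 - (\<integral>w. R i w \<partial>\<mu>) / 2" using iR \<mu>.prob_space by simp
    also have "\<dots> \<le> exp (- (\<integral>w. R i w \<partial>\<mu>) / 2)"
      using exp_ge_add_one_self[of "- (\<integral>w. R i w \<partial>\<mu>) / 2"] by simp
    finally show "(\<integral>\<omega>. exp (- R i (W i \<omega>)) \<partial>M) \<le> exp (- (\<integral>w. R i w \<partial>\<mu>) / 2)" .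
  qed
  also have "\<dots> = exp (- E / 2)"
    by (simp add: E exp_sum[symmetric] sum_negf sum_divide_distrib)
  finally show ?thesis by (simp add: divide_right_mono flip: exp_diff)
qed

text \<open>
  The second moment bound.  On the typical event the conditional expectation \<open>expected_large n k\<close> is at
  least a sum of independent terms, one for each vertex, with total expectation \<open>E\<close>.  Unless this sum is
  below \<open>E / 4\<close>, the conditional second moment estimate applies.
\<close>
lemma prob_all_degrees_small:
  fixes s :: "nat \<Rightarrow> real"
  assumes d: "\<And>l. J \<le> l \<Longrightarrow> 1 \<le> mean_W * real l + s l"
    and E: "E = (\<integral>w. (\<Sum>i\<in>{1..n}. bern_tail (wt_prob J 0 (\<lambda>l. mean_W * real l + s l) w i) n k) \<partial>\<mu>)"
    and "0 < E"
  shows "prob {\<omega> \<in> space M. \<forall>i\<in>{1..n}. deg n i \<omega> < k}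
    \<le> prob (space M - typical s J n) + exp (- E / 4) + 4 / E"
proof -
  define A where "A = typical s J n"
  define d where "d = (\<lambda>l. mean_W * real l + s l)"
  define R where "R = (\<lambda>i w. bern_tail (wt_prob J 0 d w i) n k)"
  have AM [measurable]: "A \<in> sets M" unfolding A_def by (rule typical_weights)
  have d1: "1 \<le> d l" if "J \<le> l" for l using assms(1)[OF that] by (simp add: d_def)
  have RM [measurable]: "R i \<in> borel_measurable borel" for i unfolding R_def by measurable
  have R01: "0 \<le> R i w \<and> R i w \<le> 1" if "0 < w" "w \<le> 1" for i w
    unfolding R_def using that d1
    by (auto intro!: bern_tail_bounds wt_prob_bounds)
  have Rint: "integrable \<mu> (R i)" for i
    using R01 by (intro law_integrable[of _ 1]) auto
  have E': "E = (\<Sum>i\<in>{1..n}. \<integral>w. R i w \<partial>\<mu>)"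
    unfolding E using Rint by (simp add: Bochner_Integration.integral_sum R_def d_def)
  have Wm [measurable]: "i \<in> {1..n} \<Longrightarrow> W i \<in> borel_measurable M" for i using W_borel by simp
  let ?Y = "\<lambda>\<omega>. \<Sum>i\<in>{1..n}. R i (W i \<omega>)"
  let ?B = "{\<omega> \<in> space M. ?Y \<omega> \<le> E / 4}"
  let ?N = "{\<omega> \<in> space M. \<not> (\<forall>i\<ge>1. 0 < W i \<omega> \<and> W i \<omega> \<le> 1)}"
  let ?C = "{\<omega> \<in> space M. (\<forall>i\<in>{1..n}. deg n i \<omega> < k) \<and> E / 4 \<le> expected_large n k \<omega>}"
  have small: "{\<omega> \<in> space M. \<forall>i\<in>{1..n}. deg n i \<omega> < k} \<in> sets M"
  proof -
    have "{\<omega> \<in> space M. \<forall>i\<in>{1..n}. deg n i \<omega> < k}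
        = space M - (\<Union>i\<in>{1..n}. {\<omega> \<in> space M. k \<le> deg n i \<omega>})"
      by (auto simp: not_le)
    also have "\<dots> \<in> sets M" using sets_deg by auto
    finally show ?thesis .
  qed
  have [measurable]: "expected_large n k \<in> borel_measurable M"
    by (rule weights_M[OF expected_large_weights])
  have CM: "?C \<in> sets M"
  proof -
    have "?C = {\<omega> \<in> space M. \<forall>i\<in>{1..n}. deg n i \<omega> < k} \<inter> {\<omega> \<in> space M. E / 4 \<le> expected_large n k \<omega>}"
      by auto
    also have "\<dots> \<in> sets M" by (rule sets.Int[OF small]) measurable
    finally show ?thesis .
  qed
  have BM: "?B \<in> sets M" by measurable
  have "prob {\<omega> \<in> space M. \<forall>i\<in>{1..n}. deg n i \<omega> < k} \<le> prob (((space M - A) \<union> ?B) \<union> ?C)"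
  proof (rule finite_measure_mono_AE)
    show "AE \<omega> in M. \<omega> \<in> {\<omega> \<in> space M. \<forall>i\<in>{1..n}. deg n i \<omega> < k} \<longrightarrow> \<omega> \<in> ((space M - A) \<union> ?B) \<union> ?C"
      using AE_weights_bounds
    proof eventually_elim
      case (elim \<omega>)
      have "?Y \<omega> \<le> expected_large n k \<omega>" if "\<omega> \<in> A"
        unfolding expected_large_def R_def
      proof (intro sum_mono bern_tail_mono conjI)
        fix i l assume i: "i \<in> {1..n}" and l: "l < n"
        then show "0 \<le> wt_prob J 0 d (W i \<omega>) i l"
          using elim d1 by (intro wt_prob_bounds) (auto intro: less_imp_le)
        show "wt_prob J 0 d (W i \<omega>) i l \<le> attach_prob i \<omega> l"
          unfolding d_def using that elim i l assms(1)[of l]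
          by (intro wt_prob_le_attach_prob[of \<omega> s J n]) (auto simp: A_def not_le)
        show "attach_prob i \<omega> l \<le> 1" by (rule attach_prob_bounds)
      qed
      then show ?case by (auto simp: not_le)
    qed
    show "((space M - A) \<union> ?B) \<union> ?C \<in> sets M" using BM CM AM by blast
  qed
  also have "\<dots> \<le> prob ((space M - A) \<union> ?B) + prob ?C"
    using BM CM by (intro measure_Un_le) auto
  also have "prob ((space M - A) \<union> ?B) \<le> prob (space M - A) + prob ?B"
    using BM by (intro measure_Un_le) auto
  also have "prob ?B \<le> exp (- E / 4)"
    using R01 RM E' by (intro prob_small_sum) auto
  also have "prob ?C \<le> 1 / (E / 4)"
    using \<open>0 < E\<close> by (intro prob_no_large_degree) auto
  finally show ?thesis by (simp add: A_def)
qed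

end

section \<open>Analytic estimates\<close>

text \<open>
  The starting time \<open>J\<close>: from there on the fluctuations \<open>l powr (2/3)\<close> of the weight sums are small
  compared to their means, their effect on the growth of the tails is bounded, and the probability of
  ever leaving this range is at most \<open>e\<close>.  The exponent \<open>2/3\<close> could be any number strictly between
  \<open>1/2\<close> and \<open>1\<close>.
\<close>
lemma exists_starting_index:
  fixes m e :: real
  assumes m: "0 < m" and e: "0 < e"
  obtains J :: nat where "2 \<le> J"
    "\<And>l. J \<le> l \<Longrightarrow> real l powr (2/3) \<le> m * real l / 2"
    "\<And>l. J \<le> l \<Longrightarrow> 1 \<le> m * real l - real l powr (2/3)"
    "\<And>n. (\<Sum>l=J..<n. 2 / m * real l powr (-4/3)) \<le> 1/2"
    "\<And>n. (\<Sum>l=J..<n. 2 * exp (- 2 * (real l powr (2/3))\<^sup>2 / real l)) \<le> e"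
proof -
  have 1: "eventually (\<lambda>l::nat. real l powr (2/3) \<le> m * real l / 2) at_top"
    using m by real_asymp
  have 2: "eventually (\<lambda>l::nat. 1 \<le> m * real l - real l powr (2/3)) at_top"
    using m by real_asymp
  have "summable (\<lambda>l. 2 / m * real l powr (-4/3))"
    by (intro summable_mult) (simp add: summable_real_powr_iff)
  then obtain N3 where N3: "\<And>k n. N3 \<le> k \<Longrightarrow> norm (\<Sum>l=k..<n. 2 / m * real l powr (-4/3)) < 1/2"
    unfolding summable_Cauchy by (metis half_gt_zero_iff zero_less_one)
  have "summable (\<lambda>l. 2 * exp (- 2 * (real l powr (2/3))\<^sup>2 / real l))"
  proof (rule summable_comparison_test_bigo)
    show "summable (\<lambda>l. norm (real l powr (-2)))"
      by (simp add: summable_real_powr_iff)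
    show "(\<lambda>l. 2 * exp (- 2 * (real l powr (2/3))\<^sup>2 / real l)) \<in> O(\<lambda>l. real l powr (-2))"
      by real_asymp
  qed
  then obtain N4 where N4: "\<And>k n. N4 \<le> k \<Longrightarrow>
      norm (\<Sum>l=k..<n. 2 * exp (- 2 * (real l powr (2/3))\<^sup>2 / real l)) < e"
    unfolding summable_Cauchy using e by metis
  from 1 2 obtain N1 N2 where N: "\<And>l. N1 \<le> l \<Longrightarrow> real l powr (2/3) \<le> m * real l / 2"
      "\<And>l. N2 \<le> l \<Longrightarrow> 1 \<le> m * real l - real l powr (2/3)"
    unfolding eventually_sequentially by blast
  define J where "J = Max {2, N1, N2, N3, N4}"
  have J: "2 \<le> J" "N1 \<le> J" "N2 \<le> J" "N3 \<le> J" "N4 \<le> J" by (auto simp: J_def)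
  show ?thesis
  proof (rule that[of J])
    show "(\<Sum>l=J..<n. 2 / m * real l powr (-4/3)) \<le> 1/2" for n
      by (rule order.trans[OF abs_ge_self less_imp_le[OF N3[OF J(4), of n, unfolded real_norm_def]]])
    show "(\<Sum>l=J..<n. 2 * exp (- 2 * (real l powr (2/3))\<^sup>2 / real l)) \<le> e" for n
      by (rule order.trans[OF abs_ge_self less_imp_le[OF N4[OF J(5), of n, unfolded real_norm_def]]])
  qed (use J N in auto)
qed

text \<open>
  This estimate and the next one quantify how far the growth factor \<open>1 + m / d\<close> deviates from
  \<open>(l + 1) / l\<close>, its value for \<open>d = m * l\<close>, if \<open>m * l\<close> is replaced by \<open>m * l - s\<close> or \<open>m * l + s\<close>.
\<close>
lemma growth_upper:
  fixes m s x l :: real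
  assumes "0 < m" "1 \<le> l" "0 \<le> s" "s \<le> m * l / 2" "x = 2 / m * (s / l\<^sup>2)"
  shows "l * (1 + m / (m * l - s)) \<le> (l + 1) * exp x"
proof -
  have l: "l > 0" using assms by simp
  have d: "0 < m * l / 2" "m * l / 2 \<le> m * l - s" using assms l by (simp_all add: mult.commute)
  have "l * (1 + m / (m * l - s)) = (l + 1) * (1 + s / ((l + 1) * (m * l - s)))"
  proof -
    have "l * (1 + m / (m * l - s)) * (m * l - s) = (l + 1) * (m * l - s) + s"
      using d by (simp add: field_simps)
    moreover have "(l + 1) * (1 + s / ((l + 1) * (m * l - s))) * (m * l - s) = (l + 1) * (m * l - s) + s"
    proof -
      have "(l + 1) * (s / ((l + 1) * (m * l - s))) * (m * l - s) = s"
      proof -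
        have "m * l - s \<noteq> 0" "l + 1 \<noteq> 0" using d l by linarith+
        then show ?thesis by simp
      qed
      then show ?thesis by (simp add: distrib_left distrib_right)
    qed
    ultimately show ?thesis using d by (metis less_le_trans mult_cancel_right less_irrefl)
  qed
  also have "s / ((l + 1) * (m * l - s)) \<le> s / (l * (m * l / 2))"
    using assms(3) d l by (intro frac_le mult_mono mult_pos_pos) linarith+
  also have "\<dots> = x" using assms l by (simp add: power2_eq_square field_simps)
  also have "1 + x \<le> exp x" by (rule exp_ge_add_one_self)
  finally show ?thesis using l by (simp add: mult_left_mono)
qed

lemma growth_lower:
  fixes m s x l :: real
  assumes "0 < m" "1 \<le> l" "0 \<le> s" "x = 2 / m * (s / l\<^sup>2)"
  shows "(l + 1) * (1 - x) \<le> l * (1 + m / (m * l + s))"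
proof -
  have l: "l > 0" using assms by simp
  have d0: "0 < m * l" using assms l by simp
  then have d: "0 < m * l + s" "m * l \<le> m * l + s" using assms(3) by linarith+
  have "s / ((l + 1) * (m * l + s)) \<le> s / (l * (m * l))"
    using assms(1,3) d d0 l by (intro frac_le mult_mono mult_pos_pos) linarith+
  also have "\<dots> \<le> x" using assms l by (simp add: power2_eq_square field_simps)
  finally have "(l + 1) * (1 - x) \<le> (l + 1) * (1 - s / ((l + 1) * (m * l + s)))"
    using l by (intro mult_left_mono) auto
  also have "\<dots> = l * (1 + m / (m * l + s))"
  proof -
    have "l * (1 + m / (m * l + s)) * (m * l + s) = (l + 1) * (m * l + s) - s"
      using d by (simp add: field_simps)
    moreover have "(l + 1) * (1 - s / ((l + 1) * (m * l + s))) * (m * l + s) = (l + 1) * (m * l + s) - s"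
    proof -
      have "(l + 1) * (s / ((l + 1) * (m * l + s))) * (m * l + s) = s" using d l by simp
      then show ?thesis by (simp add: right_diff_distrib left_diff_distrib)
    qed
    ultimately show ?thesis using d by (metis less_le_trans mult_cancel_right less_irrefl)
  qed
  finally show ?thesis .
qed

lemma bounded_by_doubling:
  fixes G :: "real \<Rightarrow> real"
  assumes x0: "0 < x0"
    and double: "\<And>x. x0 \<le> x \<Longrightarrow> G (2 * x) \<le> G x"
    and init: "\<And>x. x0 \<le> x \<Longrightarrow> x \<le> 2 * x0 \<Longrightarrow> G x \<le> C"
    and "x0 \<le> x"
  shows "G x \<le> C"
proof -
  have "G x \<le> C" if "x0 \<le> x" "x \<le> 2 ^ k * x0" for k x
    using that
  proof (induction k arbitrary: x)
    case 0
    then show ?case using x0 by (intro init) auto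
  next
    case (Suc k)
    show ?case
    proof (cases "x \<le> 2 * x0")
      case True
      then show ?thesis using Suc.prems init by blast
    next
      case False
      then have "G (2 * (x / 2)) \<le> G (x / 2)" "G (x / 2) \<le> C"
        using Suc.prems by (intro double Suc.IH; simp)+
      then show ?thesis by simp
    qed
  qed
  moreover obtain k where "x / x0 < 2 ^ k"
    using real_arch_pow[of 2 "x / x0"] by auto
  then have "x \<le> 2 ^ k * x0" using x0 by (simp add: divide_less_eq less_imp_le)
  ultimately show ?thesis using assms by blast
qed

text \<open>
  A monotone regularly varying function has the same order as the power function up to an arbitrarily
  small exponent.  By monotonicity only the ratios \<open>L (2 * x) / L x\<close> are needed.
\<close>
lemma regularly_varying_bounds:
  fixes F L :: "real \<Rightarrow> real"
  assumes F: "\<And>x. 0 < x \<Longrightarrow> F x = L x * x powr (- a)"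
    and L: "\<And>x. 0 < x \<Longrightarrow> 0 < L x" "slowly_varying L"
    and anti: "\<And>x y. 0 < x \<Longrightarrow> x \<le> y \<Longrightarrow> F y \<le> F x"
    and a: "0 < a" and \<delta>: "0 < \<delta>"
  shows "eventually (\<lambda>x. F x \<le> x powr (- a + \<delta>)) at_top"
    and "eventually (\<lambda>x. x powr (- a - \<delta>) \<le> F x) at_top"
proof -
  define \<eta> where "\<eta> = \<delta> / 2"
  have \<eta>: "0 < \<eta>" using \<delta> by (simp add: \<eta>_def)
  have lim: "((\<lambda>x. L (2 * x) / L x) \<longlongrightarrow> 1) at_top"
    using L(2) by (simp add: slowly_varying_def)
  have "eventually (\<lambda>x. L (2 * x) / L x < 2 powr \<eta>) at_top"
    using order_tendstoD(2)[OF lim] \<eta> by simp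
  moreover have "eventually (\<lambda>x. 2 powr (- \<eta>) < L (2 * x) / L x) at_top"
    using order_tendstoD(1)[OF lim] \<eta> by (simp add: powr_less_one)
  ultimately have "eventually (\<lambda>x. 2 powr (- \<eta>) < L (2 * x) / L x \<and> L (2 * x) / L x < 2 powr \<eta>) at_top"
    by eventually_elim simp
  then obtain x1 where x1: "\<And>x. x1 \<le> x \<Longrightarrow> 2 powr (- \<eta>) < L (2 * x) / L x \<and> L (2 * x) / L x < 2 powr \<eta>"
    unfolding eventually_at_top_linorder by blast
  define x0 where "x0 = max 1 x1"
  have x0: "1 \<le> x0" "x1 \<le> x0" by (auto simp: x0_def)
  have ratio: "2 powr (- \<eta>) * L x \<le> L (2 * x)" "L (2 * x) \<le> 2 powr \<eta> * L x" if "x0 \<le> x" for x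
    using x1[of x] L(1)[of x] x0 that by (auto simp: field_simps less_imp_le)
  have Fpos: "0 < F x" if "0 < x" for x using F L(1) that by simp
  have up: "F x * x powr (a - \<eta>) \<le> F x0 * (2 * x0) powr a" if "x0 \<le> x" for x
  proof (rule bounded_by_doubling[of x0 "\<lambda>x. F x * x powr (a - \<eta>)"])
    fix y assume y: "x0 \<le> y"
    then have y0: "0 < y" using x0 by simp
    have eq: "F z * z powr (a - \<eta>) = L z * z powr (- \<eta>)" if "0 < z" for z
      using F[OF that] by (simp add: mult.assoc flip: powr_add)
    have "L (2 * y) * (2 * y) powr (- \<eta>) \<le> 2 powr \<eta> * L y * (2 * y) powr (- \<eta>)"
      using ratio(2)[OF y] by (intro mult_right_mono) auto
    also have "\<dots> = L y * y powr (- \<eta>)"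
      using y0 by (simp add: powr_mult mult_ac flip: powr_add)
    finally show "F (2 * y) * (2 * y) powr (a - \<eta>) \<le> F y * y powr (a - \<eta>)"
      using eq[of y] eq[of "2 * y"] y0 by simp
  next
    fix y assume y: "x0 \<le> y" "y \<le> 2 * x0"
    have "y powr (a - \<eta>) \<le> y powr a" using y x0 \<eta> by (intro powr_mono) auto
    also have "\<dots> \<le> (2 * x0) powr a" using y x0 a by (intro powr_mono2) auto
    finally show "F y * y powr (a - \<eta>) \<le> F x0 * (2 * x0) powr a"
      using y x0 anti[of x0 y] Fpos[of x0] by (intro mult_mono) auto
  qed (use x0 that in auto)
  have low: "F (2 * x0) * x0 powr a \<le> F x * x powr (a + \<eta>)" if "x0 \<le> x" for x
  proof -
    have "- (F x * x powr (a + \<eta>)) \<le> - (F (2 * x0) * x0 powr a)"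
    proof (rule bounded_by_doubling[of x0 "\<lambda>x. - (F x * x powr (a + \<eta>))"])
      fix y assume y: "x0 \<le> y"
      then have y0: "0 < y" using x0 by simp
      have eq: "F z * z powr (a + \<eta>) = L z * z powr \<eta>" if "0 < z" for z
        using F[OF that] by (simp add: mult.assoc flip: powr_add)
      have "L y * y powr \<eta> = 2 powr (- \<eta>) * L y * (2 * y) powr \<eta>"
        using y0 by (simp add: powr_mult powr_minus field_simps)
      also have "\<dots> \<le> L (2 * y) * (2 * y) powr \<eta>"
        using ratio(1)[OF y] by (intro mult_right_mono) auto
      finally show "- (F (2 * y) * (2 * y) powr (a + \<eta>)) \<le> - (F y * y powr (a + \<eta>))"
        using eq[of y] eq[of "2 * y"] y0 by simp
    next
      fix y assume y: "x0 \<le> y" "y \<le> 2 * x0"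
      have "x0 powr a \<le> y powr a" using y x0 a by (intro powr_mono2) auto
      also have "\<dots> \<le> y powr (a + \<eta>)" using y x0 \<eta> by (intro powr_mono) auto
      finally have "F (2 * x0) * x0 powr a \<le> F y * y powr (a + \<eta>)"
        using y x0 anti[of y "2 * x0"] Fpos[of y] by (intro mult_mono) auto
      then show "- (F y * y powr (a + \<eta>)) \<le> - (F (2 * x0) * x0 powr a)" by simp
    qed (use x0 that in auto)
    then show ?thesis by simp
  qed
  define C where "C = F x0 * (2 * x0) powr a"
  define c where "c = F (2 * x0) * x0 powr a"
  have c: "0 < c" using Fpos[of "2 * x0"] x0 by (simp add: c_def)
  have "eventually (\<lambda>x. C \<le> x powr \<eta>) at_top" using \<eta> by real_asymp
  then show "eventually (\<lambda>x. F x \<le> x powr (- a + \<delta>)) at_top"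
    using eventually_ge_at_top[of x0]
  proof eventually_elim
    case (elim x)
    have "F x * x powr (a - \<eta>) \<le> x powr \<eta>"
      using up[OF elim(2)] elim(1) unfolding C_def by simp
    then have "F x * x powr (a - \<eta>) * x powr (\<eta> - a) \<le> x powr \<eta> * x powr (\<eta> - a)"
      by (intro mult_right_mono) auto
    then show ?case using elim x0 by (simp add: mult.assoc \<eta>_def flip: powr_add)
  qed
  have "eventually (\<lambda>x. x powr (- \<eta>) \<le> c) at_top" using \<eta> c by real_asymp
  then show "eventually (\<lambda>x. x powr (- a - \<delta>) \<le> F x) at_top"
    using eventually_ge_at_top[of x0]
  proof eventually_elim
    case (elim x)
    have "x powr (- \<eta>) \<le> F x * x powr (a + \<eta>)"
      using low[OF elim(2)] elim(1) unfolding c_def by simp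
    then have "x powr (- \<eta>) * x powr (- a - \<eta>) \<le> F x * x powr (a + \<eta>) * x powr (- a - \<eta>)"
      by (intro mult_right_mono) auto
    then show ?case using elim x0 by (simp add: mult.assoc \<eta>_def minus_diff_commute[of \<delta>] flip: powr_add)
  qed
qed

lemma upper_limit:
  fixes B p c \<eta> K :: real
  assumes "B < p" "0 < c" "0 < \<eta>"
  shows "((\<lambda>x. K * x powr B * (x powr (- p) + exp (- c * x powr \<eta>))) \<longlongrightarrow> 0) at_top"
  using assms by real_asymp

lemma lower_limit:
  fixes B p c K \<theta> :: real
  assumes "p < B" "0 < c" "1 < \<theta>"
  shows "filterlim (\<lambda>x. (x powr B / (4 * \<theta>) - K * x powr (B / 2) * exp (- c * x)) * (2 * x) powr (- p)) at_top at_top"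
  using assms by real_asymp

section \<open>Regularly varying tails and the limit of the maximal in-degree\<close>

lemma powr_ratio_sq:
  assumes "1 \<le> l"
  shows "real l powr (2/3) / (real l)\<^sup>2 = real l powr (-4/3)"
proof -
  have "(real l)\<^sup>2 = real l powr 2" using assms by simp
  then have "real l powr (2/3) / (real l)\<^sup>2 = real l powr (2/3 - 2)" by (simp only: powr_diff)
  then show ?thesis by simp
qed

context bounded_weighted_recursive_tree
begin

text \<open>
  The ratio \<open>w / (m + w)\<close>, with \<open>m\<close> the mean weight, is at most
  \<open>exp (- (m / (1 + m)) * (1 - w)) / (1 + m)\<close>.  Hence only weights within \<open>1 / y\<close> of \<open>1\<close>
  contribute to the integral if \<open>y\<close> is smaller than \<open>N\<close> by a power of \<open>N\<close>.
\<close>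
lemma integral_power_le:
  assumes y: "0 < y"
  shows "(\<integral>w. (w / (mean_W + w)) ^ N \<partial>\<mu>)
    \<le> (1 / (1 + mean_W)) ^ N * (measure \<mu> {1 - 1 / y..} + exp (- (mean_W / (1 + mean_W)) * (real N / y)))"
proof -
  interpret \<mu>: prob_space \<mu> by (rule prob_space_law)
  define c where "c = mean_W / (1 + mean_W)"
  have c: "0 < c" using mean_W_pos by (simp add: c_def)
  define e where "e = exp (- c * (real N / y))"
  have iset: "integrable \<mu> (indicator {1 - 1 / y..} :: real \<Rightarrow> real)"
    by (rule law_integrable[of _ 1]) (auto simp: indicator_def)
  have "(\<integral>w. (w / (mean_W + w)) ^ N \<partial>\<mu>) \<le> (\<integral>w. (1 / (1 + mean_W)) ^ N * (indicator {1 - 1 / y..} w + e) \<partial>\<mu>)"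
  proof (rule integral_mono_AE)
    show "integrable \<mu> (\<lambda>w. (w / (mean_W + w)) ^ N)"
      using mean_W_pos by (intro law_integrable[of _ 1]) (auto intro!: power_le_one)
    show "integrable \<mu> (\<lambda>w. (1 / (1 + mean_W)) ^ N * (indicator {1 - 1 / y..} w + e))"
      using iset by simp
    show "AE w in \<mu>. (w / (mean_W + w)) ^ N \<le> (1 / (1 + mean_W)) ^ N * (indicator {1 - 1 / y..} w + e)"
      using law_bounds
    proof eventually_elim
      case (elim w)
      have "w * (1 + mean_W) / (mean_W + w) = 1 - mean_W * (1 - w) / (mean_W + w)"
        using mean_W_pos elim by (simp add: field_simps)
      also have "mean_W * (1 - w) / (1 + mean_W) \<le> mean_W * (1 - w) / (mean_W + w)"
        using mean_W_pos elim by (intro divide_left_mono mult_nonneg_nonneg mult_pos_pos) auto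
      then have "1 - mean_W * (1 - w) / (mean_W + w) \<le> 1 - c * (1 - w)" by (simp add: c_def)
      also have "\<dots> \<le> exp (- c * (1 - w))"
        using exp_ge_add_one_self[of "- c * (1 - w)"] by simp
      finally have "w / (mean_W + w) \<le> 1 / (1 + mean_W) * exp (- c * (1 - w))"
        using mean_W_pos by (simp add: field_simps)
      then have "(w / (mean_W + w)) ^ N \<le> (1 / (1 + mean_W) * exp (- c * (1 - w))) ^ N"
        using elim mean_W_pos by (intro power_mono) auto
      also have "\<dots> = (1 / (1 + mean_W)) ^ N * exp (- c * (real N * (1 - w)))"
        unfolding power_mult_distrib by (simp add: mult_ac flip: exp_of_nat_mult)
      also have "exp (- c * (real N * (1 - w))) \<le> indicator {1 - 1 / y..} w + e"
      proof (cases "1 - 1 / y \<le> w")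
        case True
        then show ?thesis using c elim by (simp add: e_def add_increasing2)
      next
        case False
        then have "real N * (1 / y) \<le> real N * (1 - w)" by (intro mult_left_mono) auto
        then have "c * (real N / y) \<le> c * (real N * (1 - w))"
          using c by (intro mult_left_mono) auto
        then show ?thesis using False by (simp add: e_def)
      qed
      finally show ?case using mean_W_pos by (simp add: mult_left_mono)
    qed
  qed
  also have "\<dots> = (1 / (1 + mean_W)) ^ N * (measure \<mu> {1 - 1 / y..} + e)"
    using iset \<mu>.prob_space by simp
  finally show ?thesis by (simp add: e_def c_def)
qed

text \<open>
  For the lower bound, vertices of weight at least \<open>1 - 1 / (2 * x)\<close> suffice: for these the power
  \<open>w ^ k\<close> is at least \<open>1/2\<close> by Bernoulli's inequality.
\<close>
lemma integral_sum_tail_lower: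
  fixes n k J :: nat and x z :: real
  defines "T \<equiv> \<lambda>w. \<Sum>i\<in>{1..n}. bern_tail (wt_prob J 0 (\<lambda>l. mean_W * real l + real l powr (2/3)) w i) n k"
  assumes J: "2 \<le> J" "J \<le> n"
    and d: "\<And>l. J \<le> l \<Longrightarrow> 1 \<le> mean_W * real l + real l powr (2/3)"
    and S: "\<And>n. (\<Sum>l=J..<n. 2 / mean_W * real l powr (-4/3)) \<le> 1/2"
    and z: "1 \<le> z" "z \<le> 1 + mean_W"
    and x: "1 \<le> x" "real k \<le> x"
  shows "(real n / 4 * (1 / (1 + mean_W)) ^ k - real J * (1 / z) ^ k * real n powr ((z - 1) / mean_W))
      * measure \<mu> {1 - 1 / (2 * x)..} \<le> (\<integral>w. T w \<partial>\<mu>)"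
proof -
  interpret \<mu>: prob_space \<mu> by (rule prob_space_law)
  define v where "v = real n / 4 * (1 / (1 + mean_W)) ^ k - real J * (1 / z) ^ k * real n powr ((z - 1) / mean_W)"
  let ?I = "{1 - 1 / (2 * x)..}"
  have iset: "integrable \<mu> (indicator ?I :: real \<Rightarrow> real)"
    by (rule law_integrable[of _ 1]) (auto simp: indicator_def)
  have b01: "0 \<le> bern_tail (wt_prob J 0 (\<lambda>l. mean_W * real l + real l powr (2/3)) w i) n k
      \<and> bern_tail (wt_prob J 0 (\<lambda>l. mean_W * real l + real l powr (2/3)) w i) n k \<le> 1"
    if "0 < w" "w \<le> 1" for w i
    using that d by (auto intro!: bern_tail_bounds wt_prob_bounds)
  have Tint: "integrable \<mu> T"
    unfolding T_def using b01 by (intro Bochner_Integration.integrable_sum law_integrable[of _ 1]) auto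
  have "v * measure \<mu> ?I = (\<integral>w. v * indicator ?I w \<partial>\<mu>)" using iset by simp
  also have "\<dots> \<le> (\<integral>w. T w \<partial>\<mu>)"
  proof (rule integral_mono_AE)
    show "AE w in \<mu>. v * indicator ?I w \<le> T w"
      using law_bounds
    proof eventually_elim
      case (elim w)
      show ?case
      proof (cases "w \<in> ?I")
        case False
        then show ?thesis using b01 elim by (auto simp: T_def intro!: sum_nonneg)
      next
        case True
        define s where "s = (\<Sum>l=J..<n. 2 / mean_W * real l powr (-4/3))"
        have low: "real n * (1 - s) * (w / (mean_W + w)) ^ k
            - real J * (1 / z) ^ k * (real n - 1) powr ((z - 1) / mean_W) \<le> T w"
          unfolding T_def s_def
        proof (rule sum_bern_tail_lower)
          show "(\<Sum>l=J..<n. 2 / mean_W * real l powr (- 4/3)) \<le> 1" for n using S[of n] by linarith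
          fix l assume "J \<le> l"
          then have l: "1 \<le> l" using J by simp
          show "(real l + 1) * (1 - 2 / mean_W * real l powr (- 4/3)) \<le> real l * (1 + mean_W / (mean_W * real l + real l powr (2/3)))"
            using mean_W_pos l by (intro growth_lower) (simp_all add: powr_ratio_sq)
        qed (use mean_W_pos elim J d z in auto)
        have "1/2 \<le> (1 - 1 / (2 * x)) ^ k"
        proof -
          have "real k / (2 * x) \<le> 1 / 2" using x by (simp add: field_simps)
          then have "1/2 \<le> 1 + real k * (- (1 / (2 * x)))" by simp
          also have "\<dots> \<le> (1 + (- (1 / (2 * x)))) ^ k"
            using x by (intro Bernoulli_inequality) (simp add: field_simps)
          finally show ?thesis by simp
        qed
        also have "\<dots> \<le> w ^ k" using True x by (intro power_mono) (auto simp: field_simps)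
        finally have "(1 / (1 + mean_W)) ^ k * (1/2) \<le> (1 / (1 + mean_W)) ^ k * w ^ k"
          using mean_W_pos by (intro mult_left_mono) auto
        also have "\<dots> = (w / (1 + mean_W)) ^ k" by (simp add: power_divide)
        also have "\<dots> \<le> (w / (mean_W + w)) ^ k"
          using mean_W_pos elim by (intro power_mono divide_left_mono mult_pos_pos) auto
        finally have q: "(1 / (1 + mean_W)) ^ k * (1/2) \<le> (w / (mean_W + w)) ^ k" .
        have "real n * (1/2) * ((1 / (1 + mean_W)) ^ k * (1/2)) \<le> real n * (1 - s) * (w / (mean_W + w)) ^ k"
          using q S[of n] mean_W_pos by (intro mult_mono) (auto simp: s_def)
        moreover have "real J * (1 / z) ^ k * (real n - 1) powr ((z - 1) / mean_W)
            \<le> real J * (1 / z) ^ k * real n powr ((z - 1) / mean_W)"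
          using z mean_W_pos J by (intro mult_left_mono powr_mono2) auto
        ultimately have "v \<le> T w" using low unfolding v_def by simp
        then show ?thesis using True by simp
      qed
    qed
  qed (use iset Tint in auto)
  finally show ?thesis by (simp add: v_def)
qed

end

text \<open>
  The tail of the weight distribution at its right endpoint \<open>1\<close> is regularly varying with exponent
  \<open>a > 0\<close>.
\<close>
locale weibull_weighted_recursive_tree = bounded_weighted_recursive_tree +
  fixes a :: real and L :: "real \<Rightarrow> real"
  assumes a_pos: "0 < a"
    and L_pos: "\<And>x. 0 < x \<Longrightarrow> 0 < L x"
    and L_slow: "slowly_varying L"
    and law_tail: "\<And>x. 0 < x \<Longrightarrow> measure \<mu> {1 - 1 / x..} = L x * x powr (- a)"
begin

definition \<theta> :: real where "\<theta> = 1 + mean_W"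

lemma theta_gt_1: "1 < \<theta>"
  using mean_W_pos by (simp add: \<theta>_def)

lemma tail_bounds_eventually:
  assumes "0 < \<delta>"
  shows "eventually (\<lambda>x. measure \<mu> {1 - 1 / x..} \<le> x powr (- a + \<delta>)) at_top"
    and "eventually (\<lambda>x. x powr (- a - \<delta>) \<le> measure \<mu> {1 - 1 / x..}) at_top"
proof -
  interpret \<mu>: prob_space \<mu> by (rule prob_space_law)
  have anti: "measure \<mu> {1 - 1 / y..} \<le> measure \<mu> {1 - 1 / x..}" if "0 < x" "x \<le> y" for x y :: real
    using that by (intro \<mu>.finite_measure_mono) (auto simp: sets_law frac_le)
  show "eventually (\<lambda>x. measure \<mu> {1 - 1 / x..} \<le> x powr (- a + \<delta>)) at_top"
    and "eventually (\<lambda>x. x powr (- a - \<delta>) \<le> measure \<mu> {1 - 1 / x..}) at_top"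
    using regularly_varying_bounds[of "\<lambda>x. measure \<mu> {1 - 1 / x..}" L a \<delta>,
        OF law_tail L_pos L_slow anti a_pos assms] by auto
qed

lemma filterlim_log_theta: "filterlim (\<lambda>n. log \<theta> (real n)) at_top sequentially"
proof -
  have "0 < ln \<theta>" using theta_gt_1 by simp
  then show ?thesis unfolding log_def by real_asymp
qed

lemma prob_typical_le:
  assumes "1 \<le> J" "\<And>n. (\<Sum>l=J..<n. 2 * exp (- 2 * (real l powr (2/3))\<^sup>2 / real l)) \<le> e"
  shows "prob (space M - typical (\<lambda>l. real l powr (2/3)) J n) \<le> e"
  using prob_not_typical[OF assms(1), of "\<lambda>l. real l powr (2/3)" n] assms(2)[of n] by simp

text \<open>
  With \<open>x = log \<theta> n\<close> and \<open>k\<close> the integer above \<open>x - B * log \<theta> x\<close>, the expected number of vertices of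
  in-degree at least \<open>k\<close> is of order \<open>n * \<theta> powr (- k) * x powr (- a)\<close>, that is \<open>x powr (B - a)\<close>, up to
  an arbitrarily small power of \<open>x\<close>.
\<close>
lemma upper_event_small:
  assumes B: "B < a" and e: "0 < e"
  shows "eventually (\<lambda>n. prob {\<omega> \<in> space M. \<exists>i\<in>{1..n}.
      log \<theta> (real n) - B * log \<theta> (log \<theta> (real n)) < real (deg n i \<omega>)} < e) sequentially"
proof -
  obtain J where J: "2 \<le> J"
      "\<And>l. J \<le> l \<Longrightarrow> real l powr (2/3) \<le> mean_W * real l / 2"
      "\<And>l. J \<le> l \<Longrightarrow> 1 \<le> mean_W * real l - real l powr (2/3)"
      "\<And>n. (\<Sum>l=J..<n. 2 / mean_W * real l powr (-4/3)) \<le> 1/2"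
      "\<And>n. (\<Sum>l=J..<n. 2 * exp (- 2 * (real l powr (2/3))\<^sup>2 / real l)) \<le> e / 2"
    using exists_starting_index[OF mean_W_pos half_gt_zero[OF e]] by blast
  have J1: "1 \<le> J" using J(1) by simp
  \<comment> \<open>Only weights within \<open>x powr (\<eta> - 1)\<close> of \<open>1\<close> matter.  The two losses of a power of \<open>x\<close> leave the
    exponent \<open>p\<close>, and \<open>\<eta>\<close> is small enough for \<open>p > B\<close>.\<close>
  define \<eta> where "\<eta> = min (1/2) ((a - B) / (2 * (1 + a)))"
  have \<eta>: "0 < \<eta>" "\<eta> \<le> 1/2"
    using B a_pos unfolding \<eta>_def by (simp, intro min.cobounded1)
  have \<eta>a: "\<eta> * (1 + a) \<le> (a - B) / 2"
  proof -
    have "\<eta> * (1 + a) \<le> (a - B) / (2 * (1 + a)) * (1 + a)"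
      using a_pos by (intro mult_right_mono) (auto simp: \<eta>_def)
    also have "\<dots> = (a - B) / 2" using a_pos by (simp add: divide_simps)
    finally show ?thesis .
  qed
  define p where "p = (1 - \<eta>) * (a - \<eta>)"
  have p: "B < p"
  proof -
    have "p = a - \<eta> * (1 + a) + \<eta> * \<eta>" by (simp add: p_def algebra_simps)
    moreover have "0 < (a - B) / 2" using B by simp
    then have "B < a - (a - B) / 2" by (simp add: field_simps)
    ultimately show ?thesis using \<eta>a zero_le_square[of \<eta>] by linarith
  qed
  define c where "c = mean_W / (1 + mean_W)"
  have c: "0 < c" using mean_W_pos by (simp add: c_def)
  define K where "K = exp (1/2) * \<theta> powr real J"
  have ln: "0 < ln \<theta>" using theta_gt_1 by simp
  have "filterlim (\<lambda>x::real. x powr (1 - \<eta>)) at_top at_top"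
    using \<eta> by real_asymp
  from eventually_compose_filterlim[OF tail_bounds_eventually(1)[OF \<eta>(1)] this]
  have ev1: "eventually (\<lambda>x. measure \<mu> {1 - 1 / (x powr (1 - \<eta>))..} \<le> (x powr (1 - \<eta>)) powr (- a + \<eta>)) at_top" .
  have ev2: "eventually (\<lambda>x. x / 2 \<le> x - B * log \<theta> x - real J) at_top"
    unfolding log_def using ln by real_asymp
  have ev3: "eventually (\<lambda>x. K * x powr B * (x powr (- p) + exp (- (c / 2) * x powr \<eta>)) < e / 2) at_top"
    using order_tendstoD(2)[OF upper_limit[OF p _ \<eta>(1), of "c / 2" K], of "e / 2"] c e by simp
  have "eventually (\<lambda>x. measure \<mu> {1 - 1 / (x powr (1 - \<eta>))..} \<le> (x powr (1 - \<eta>)) powr (- a + \<eta>)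
      \<and> x / 2 \<le> x - B * log \<theta> x - real J
      \<and> K * x powr B * (x powr (- p) + exp (- (c / 2) * x powr \<eta>)) < e / 2 \<and> 1 \<le> x) at_top"
    by (intro eventually_conj ev1 ev2 ev3 eventually_ge_at_top)
  from eventually_compose_filterlim[OF this filterlim_log_theta]
  show ?thesis using eventually_ge_at_top[of J]
  proof eventually_elim
    case (elim n)
    define x where "x = log \<theta> (real n)"
    define y where "y = x powr (1 - \<eta>)"
    define r where "r = x - B * log \<theta> x"
    define k where "k = nat \<lceil>r\<rceil>"
    define N where "N = k - J"
    have x: "1 \<le> x" and r: "x / 2 \<le> r - real J"
      and F: "measure \<mu> {1 - 1 / y..} \<le> x powr (- p)"
      and small: "K * x powr B * (x powr (- p) + exp (- (c / 2) * x powr \<eta>)) < e / 2"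
      using elim by (auto simp: x_def r_def y_def p_def powr_powr algebra_simps)
    have n: "0 < n" using elim J by simp
    have rk: "r \<le> real k" unfolding k_def by linarith
    have Jk: "J \<le> k"
    proof -
      have "real J \<le> real k" using r rk x by linarith
      then show ?thesis by simp
    qed
    then have Nr: "r - real J \<le> real N" using rk by (simp add: N_def of_nat_diff)
    have y: "0 < y" using x by (simp add: y_def)
    have "prob {\<omega> \<in> space M. \<exists>i\<in>{1..n}. r < real (deg n i \<omega>)}
        \<le> prob {\<omega> \<in> space M. \<exists>i\<in>{1..n}. k \<le> deg n i \<omega>}"
    proof (rule finite_measure_mono)
      show "{\<omega> \<in> space M. \<exists>i\<in>{1..n}. r < real (deg n i \<omega>)} \<subseteq> {\<omega> \<in> space M. \<exists>i\<in>{1..n}. k \<le> deg n i \<omega>}"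
        by (auto simp: k_def nat_le_iff ceiling_le_iff intro: less_imp_le)
      have "{\<omega> \<in> space M. \<exists>i\<in>{1..n}. k \<le> deg n i \<omega>} = (\<Union>i\<in>{1..n}. {\<omega> \<in> space M. k \<le> deg n i \<omega>})"
        by auto
      then show "{\<omega> \<in> space M. \<exists>i\<in>{1..n}. k \<le> deg n i \<omega>} \<in> sets M" using sets_deg by auto
    qed
    also have "\<dots> \<le> prob (space M - typical (\<lambda>l. real l powr (2/3)) J n)
        + real n * exp (\<Sum>l=J..<n. 2 / mean_W * real l powr (-4/3)) * (\<integral>w. (w / (mean_W + w)) ^ N \<partial>\<mu>)"
      unfolding N_def
    proof (rule prob_large_degree)
      fix l assume l: "J \<le> l"
      then have l1: "1 \<le> l" using J by simp
      show "real l * (1 + mean_W / (mean_W * real l - real l powr (2/3))) \<le> (real l + 1) * exp (2 / mean_W * real l powr (- 4/3))"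
        using mean_W_pos l1 J(2)[OF l] by (intro growth_upper) (simp_all add: powr_ratio_sq)
    qed (use J J1 Jk elim mean_W_pos in auto)
    also have "\<dots> \<le> e / 2 + K * x powr B * (x powr (- p) + exp (- (c / 2) * x powr \<eta>))"
    proof (intro add_mono prob_typical_le[OF J1 J(5)])
      have int: "(\<integral>w. (w / (mean_W + w)) ^ N \<partial>\<mu>)
          \<le> \<theta> powr (- (r - real J)) * (x powr (- p) + exp (- (c / 2) * x powr \<eta>))"
      proof -
        have "(\<integral>w. (w / (mean_W + w)) ^ N \<partial>\<mu>)
            \<le> (1 / (1 + mean_W)) ^ N * (measure \<mu> {1 - 1 / y..} + exp (- c * (real N / y)))"
          unfolding c_def by (rule integral_power_le[OF y])
        also have "\<dots> \<le> \<theta> powr (- (r - real J)) * (x powr (- p) + exp (- (c / 2) * x powr \<eta>))"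
        proof (intro mult_mono add_mono F)
          have "(1 / (1 + mean_W)) ^ N = \<theta> powr (- real N)"
            using theta_gt_1 by (simp add: \<theta>_def powr_minus powr_realpow power_one_over inverse_eq_divide)
          also have "\<dots> \<le> \<theta> powr (- (r - real J))"
            using Nr theta_gt_1 by (intro powr_mono) auto
          finally show "(1 / (1 + mean_W)) ^ N \<le> \<theta> powr (- (r - real J))" .
          have "x powr \<eta> / 2 = (x / 2) / y"
            using x by (simp add: y_def powr_diff)
          also have "\<dots> \<le> real N / y" using r Nr y by (intro divide_right_mono) auto
          finally have "c * (x powr \<eta> / 2) \<le> c * (real N / y)" using c by (intro mult_left_mono) auto
          then show "exp (- c * (real N / y)) \<le> exp (- (c / 2) * x powr \<eta>)" by simp
        qed auto
        finally show ?thesis .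
      qed
      have "real n = \<theta> powr x"
        using n theta_gt_1 by (simp add: x_def)
      moreover have "\<theta> powr (- (r - real J)) * \<theta> powr x = \<theta> powr real J * x powr B"
      proof -
        have "\<theta> powr (- (r - real J)) * \<theta> powr x = \<theta> powr (real J + B * log \<theta> x)"
          by (simp add: r_def flip: powr_add)
        also have "\<dots> = \<theta> powr real J * x powr B"
          using x theta_gt_1 by (simp add: powr_add mult.commute[of B] flip: powr_powr)
        finally show ?thesis .
      qed
      ultimately have n\<theta>: "real n * \<theta> powr (- (r - real J)) = \<theta> powr real J * x powr B"
        by (simp add: mult.commute)
      have "real n * exp (\<Sum>l=J..<n. 2 / mean_W * real l powr (-4/3)) * (\<integral>w. (w / (mean_W + w)) ^ N \<partial>\<mu>)
          \<le> real n * exp (1/2) * (\<theta> powr (- (r - real J)) * (x powr (- p) + exp (- (c / 2) * x powr \<eta>)))"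
      proof (intro mult_mono int)
        show "exp (\<Sum>l=J..<n. 2 / mean_W * real l powr (-4/3)) \<le> exp (1/2)"
          using J(4)[of n] by (simp only: exp_le_cancel_iff)
        show "0 \<le> (\<integral>w. (w / (mean_W + w)) ^ N \<partial>\<mu>)"
          using law_bounds mean_W_pos by (intro integral_nonneg_AE) (auto elim!: eventually_mono)
      qed auto
      also have "\<dots> = exp (1/2) * (real n * \<theta> powr (- (r - real J))) * (x powr (- p) + exp (- (c / 2) * x powr \<eta>))"
        by (simp only: mult_ac)
      also have "\<dots> = K * x powr B * (x powr (- p) + exp (- (c / 2) * x powr \<eta>))"
        unfolding n\<theta> K_def by (simp only: mult_ac)
      finally show "real n * exp (\<Sum>l=J..<n. 2 / mean_W * real l powr (-4/3)) * (\<integral>w. (w / (mean_W + w)) ^ N \<partial>\<mu>)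
          \<le> K * x powr B * (x powr (- p) + exp (- (c / 2) * x powr \<eta>))" .
    qed
    also have "\<dots> < e" using small by simp
    finally show ?case by (simp add: r_def x_def)
  qed
qed

text \<open>
  The same computation, now with \<open>B > a\<close>: the expected number of vertices of in-degree at least \<open>k\<close>
  tends to infinity.
\<close>
lemma lower_event_small:
  assumes B: "a < B" and e: "0 < e"
  shows "eventually (\<lambda>n. prob {\<omega> \<in> space M. \<forall>i\<in>{1..n}.
      real (deg n i \<omega>) < log \<theta> (real n) - B * log \<theta> (log \<theta> (real n))} < e) sequentially"
proof -
  obtain J where J: "2 \<le> J"
      "\<And>l. J \<le> l \<Longrightarrow> real l powr (2/3) \<le> mean_W * real l / 2"
      "\<And>l. J \<le> l \<Longrightarrow> 1 \<le> mean_W * real l - real l powr (2/3)"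
      "\<And>n. (\<Sum>l=J..<n. 2 / mean_W * real l powr (-4/3)) \<le> 1/2"
      "\<And>n. (\<Sum>l=J..<n. 2 * exp (- 2 * (real l powr (2/3))\<^sup>2 / real l)) \<le> e / 2"
    using exists_starting_index[OF mean_W_pos half_gt_zero[OF e]] by blast
  have J1: "1 \<le> J" using J(1) by simp
  define \<delta> where "\<delta> = (B - a) / 2"
  have \<delta>: "0 < \<delta>" using B by (simp add: \<delta>_def)
  define p where "p = a + \<delta>"
  have p: "p < B" using B by (simp add: p_def \<delta>_def field_simps)
  \<comment> \<open>With this \<open>z\<close> the correction term \<open>z powr (- k) * n powr \<gamma>\<close> is of order \<open>n powr (\<gamma> - 1/2)\<close> up to a
    power of \<open>x\<close>, where \<open>\<gamma> = 1 / (z + 1) < 1/2\<close>.\<close>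
  define z where "z = sqrt \<theta>"
  have z: "1 < z" "z * z = \<theta>" using theta_gt_1 by (auto simp: z_def)
  have z\<theta>: "z \<le> 1 + mean_W"
  proof -
    have "z * 1 \<le> z * z" using z by (intro mult_left_mono) auto
    then show ?thesis using z by (simp add: \<theta>_def)
  qed
  define \<gamma> where "\<gamma> = (z - 1) / mean_W"
  have \<gamma>: "\<gamma> < 1/2"
  proof -
    have "mean_W = (z - 1) * (z + 1)" using z(2) by (simp add: \<theta>_def algebra_simps)
    then have *: "\<gamma> = 1 / (z + 1)" using z(1) by (simp add: \<gamma>_def)
    show ?thesis unfolding * using z(1) by (simp add: field_simps)
  qed
  have ln: "0 < ln \<theta>" using theta_gt_1 by simp
  define c where "c = (1/2 - \<gamma>) * ln \<theta>"
  have c: "0 < c" using \<gamma> ln by (simp add: c_def)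
  define g where "g = (\<lambda>x. (x powr B / (4 * \<theta>) - real J * x powr (B / 2) * exp (- c * x)) * (2 * x) powr (- p))"
  have B0: "0 < B" using B a_pos by simp
  have "filterlim (\<lambda>x::real. 2 * x) at_top at_top" by real_asymp
  from eventually_compose_filterlim[OF tail_bounds_eventually(2)[OF \<delta>] this]
  have ev1: "eventually (\<lambda>x. (2 * x) powr (- a - \<delta>) \<le> measure \<mu> {1 - 1 / (2 * x)..}) at_top" .
  have ev2: "eventually (\<lambda>x. 0 \<le> x - B * log \<theta> x) at_top" "eventually (\<lambda>x. x - B * log \<theta> x + 1 \<le> x) at_top"
    unfolding log_def using ln B0 by real_asymp+
  have ev3: "eventually (\<lambda>x. 17 / e \<le> g x) at_top"
    using lower_limit[OF p c theta_gt_1, of "real J"] unfolding g_def filterlim_at_top by blast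
  have "eventually (\<lambda>x. (2 * x) powr (- a - \<delta>) \<le> measure \<mu> {1 - 1 / (2 * x)..}
      \<and> 0 \<le> x - B * log \<theta> x \<and> x - B * log \<theta> x + 1 \<le> x \<and> 17 / e \<le> g x \<and> 1 \<le> x) at_top"
    by (intro eventually_conj ev1 ev2 ev3 eventually_ge_at_top)
  from eventually_compose_filterlim[OF this filterlim_log_theta]
  show ?thesis using eventually_ge_at_top[of J]
  proof eventually_elim
    case (elim n)
    define x where "x = log \<theta> (real n)"
    define r where "r = x - B * log \<theta> x"
    define k where "k = nat \<lceil>r\<rceil>"
    define b where "b = x powr B / (4 * \<theta>) - real J * x powr (B / 2) * exp (- c * x)"
    have x: "1 \<le> x" and r: "0 \<le> r" "r + 1 \<le> x"
      and F: "(2 * x) powr (- p) \<le> measure \<mu> {1 - 1 / (2 * x)..}"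
      and g: "17 / e \<le> b * (2 * x) powr (- p)"
      using elim by (auto simp: x_def r_def p_def g_def b_def)
    have n: "0 < n" "J \<le> n" using elim J by simp_all
    have k: "r \<le> real k" "real k \<le> r + 1" using r unfolding k_def by linarith+
    define E where "E = (\<integral>w. (\<Sum>i\<in>{1..n}. bern_tail (wt_prob J 0 (\<lambda>l. mean_W * real l + real l powr (2/3)) w i) n k) \<partial>\<mu>)"
    have d: "1 \<le> mean_W * real l + real l powr (2/3)" if "J \<le> l" for l
      using J(3)[OF that] by (smt (verit) powr_ge_zero)
    have n\<theta>: "real n = \<theta> powr x" using n theta_gt_1 by (simp add: x_def)
    have \<theta>B: "\<theta> powr (s * (B * log \<theta> x)) = x powr (s * B)" for s
    proof -
      have "\<theta> powr (s * (B * log \<theta> x)) = (\<theta> powr log \<theta> x) powr (s * B)"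
        by (simp add: powr_powr mult_ac)
      then show ?thesis using x theta_gt_1 by simp
    qed
    have "(real n / 4 * (1 / (1 + mean_W)) ^ k - real J * (1 / z) ^ k * real n powr \<gamma>)
        * measure \<mu> {1 - 1 / (2 * x)..} \<le> E"
      unfolding E_def \<gamma>_def using z z\<theta> J n k r x d by (intro integral_sum_tail_lower) auto
    moreover have "b \<le> real n / 4 * (1 / (1 + mean_W)) ^ k - real J * (1 / z) ^ k * real n powr \<gamma>"
      unfolding b_def
    proof (rule diff_mono)
      have "x powr B / \<theta> = \<theta> powr (B * log \<theta> x) * \<theta> powr (- 1)"
        using \<theta>B[of 1] theta_gt_1 by (simp add: powr_minus divide_inverse)
      also have "\<dots> = \<theta> powr x * \<theta> powr (- (r + 1))"
        unfolding powr_add[symmetric] by (simp add: r_def)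
      also have "\<dots> \<le> \<theta> powr x * \<theta> powr (- real k)"
        using k theta_gt_1 by (intro mult_left_mono powr_mono) auto
      also have "\<dots> = real n * (1 / (1 + mean_W)) ^ k"
        unfolding n\<theta> using theta_gt_1
        by (simp add: \<theta>_def powr_minus powr_realpow power_one_over inverse_eq_divide)
      finally show "x powr B / (4 * \<theta>) \<le> real n / 4 * (1 / (1 + mean_W)) ^ k" by simp
      have "(1 / z) ^ k = \<theta> powr (- (real k / 2))"
      proof -
        have "(1 / z) ^ k = z powr (- real k)"
          using z by (simp add: powr_minus powr_realpow power_one_over inverse_eq_divide)
        also have "\<dots> = (\<theta> powr (1/2)) powr (- real k)"
          using theta_gt_1 by (simp add: z_def powr_half_sqrt)
        finally show ?thesis by (simp add: powr_powr)
      qed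
      also have "\<dots> \<le> \<theta> powr (- (r / 2))"
        using k theta_gt_1 by (intro powr_mono) auto
      also have "\<dots> = x powr (B / 2) * \<theta> powr (- (x / 2))"
      proof -
        have "- (r / 2) = 1/2 * (B * log \<theta> x) + - (x / 2)" by (simp add: r_def diff_divide_distrib)
        then show ?thesis by (simp only: powr_add \<theta>B) simp
      qed
      finally have "(1 / z) ^ k * real n powr \<gamma> \<le> x powr (B / 2) * \<theta> powr (- (x / 2)) * \<theta> powr (x * \<gamma>)"
        unfolding n\<theta> powr_powr by (intro mult_right_mono) auto
      also have "\<dots> = x powr (B / 2) * \<theta> powr (- (x / 2) + x * \<gamma>)"
        by (simp only: powr_add mult.assoc)
      also have "\<theta> powr (- (x / 2) + x * \<gamma>) = exp (- c * x)"
        using theta_gt_1 by (simp add: powr_def c_def algebra_simps)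
      finally show "real J * (1 / z) ^ k * real n powr \<gamma> \<le> real J * x powr (B / 2) * exp (- c * x)"
        by (simp add: mult.assoc mult_left_mono)
    qed
    moreover have b0: "0 < b"
    proof -
      have "0 < b * (2 * x) powr (- p)" using g e by (smt (verit) divide_pos_pos)
      then show ?thesis using x by (simp add: zero_less_mult_iff)
    qed
    ultimately have "b * (2 * x) powr (- p) \<le> E"
      using F by (smt (verit) mult_mono measure_nonneg powr_ge_zero mult_right_mono)
    then have E: "17 / e \<le> E" using g by simp
    then have E0: "0 < E" using e by (smt (verit) divide_pos_pos)
    have "prob {\<omega> \<in> space M. \<forall>i\<in>{1..n}. real (deg n i \<omega>) < r}
        \<le> prob {\<omega> \<in> space M. \<forall>i\<in>{1..n}. deg n i \<omega> < k}"
    proof (rule finite_measure_mono)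
      show "{\<omega> \<in> space M. \<forall>i\<in>{1..n}. real (deg n i \<omega>) < r} \<subseteq> {\<omega> \<in> space M. \<forall>i\<in>{1..n}. deg n i \<omega> < k}"
      proof safe
        fix \<omega> i assume "\<forall>i\<in>{1..n}. real (deg n i \<omega>) < r" "i \<in> {1..n}"
        then have "real (deg n i \<omega>) < real k" using k(1) by force
        then show "deg n i \<omega> < k" by simp
      qed
      have "{\<omega> \<in> space M. \<forall>i\<in>{1..n}. deg n i \<omega> < k}
          = space M - (\<Union>i\<in>{1..n}. {\<omega> \<in> space M. k \<le> deg n i \<omega>})"
        by (auto simp: not_le)
      then show "{\<omega> \<in> space M. \<forall>i\<in>{1..n}. deg n i \<omega> < k} \<in> sets M" using sets_deg by auto
    qed
    also have "\<dots> \<le> prob (space M - typical (\<lambda>l. real l powr (2/3)) J n) + exp (- E / 4) + 4 / E"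
      using d E0 by (intro prob_all_degrees_small[OF _ E_def]) auto
    also have "\<dots> \<le> e / 2 + 8 / E"
    proof -
      have "E / 4 \<le> exp (E / 4)" using exp_ge_add_one_self[of "E / 4"] by linarith
      then have "1 / exp (E / 4) \<le> 1 / (E / 4)" using E0 by (intro divide_left_mono) auto
      then have "exp (- E / 4) \<le> 4 / E" by (simp add: exp_minus inverse_eq_divide)
      moreover have "prob (space M - typical (\<lambda>l. real l powr (2/3)) J n) \<le> e / 2"
        by (rule prob_typical_le[OF J1 J(5)])
      ultimately show ?thesis by simp
    qed
    also have "\<dots> < e"
    proof -
      have "17 \<le> e * E" using E e by (simp add: divide_le_eq mult.commute)
      then have "8 / E < e / 2" using E0 by (simp add: divide_less_eq)
      then show ?thesis by simp
    qed
    finally show ?case by (simp add: r_def x_def)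
  qed
qed

lemma max_degree_limit:
  "tendsto_in_prob M
    (\<lambda>n \<omega>. MAX i\<in>{1..n}. (real (deg n i \<omega>) - log \<theta> (real n)) / log \<theta> (log \<theta> (real n)))
    (\<lambda>_. - a)"
proof -
  define V where "V = (\<lambda>n i \<omega>. (real (deg n i \<omega>) - log \<theta> (real n)) / log \<theta> (log \<theta> (real n)))"
  define X where "X = (\<lambda>n \<omega>. MAX i\<in>{1..n}. V n i \<omega>)"
  have degM [measurable]: "(\<lambda>\<omega>. real (deg n i \<omega>)) \<in> borel_measurable M" for n i
  proof -
    have "{\<omega> \<in> space M. c \<le> real (deg n i \<omega>)} \<in> sets M" for c
    proof -
      have "{\<omega> \<in> space M. c \<le> real (deg n i \<omega>)} = {\<omega> \<in> space M. nat \<lceil>c\<rceil> \<le> deg n i \<omega>}"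
        by (auto simp: nat_le_iff ceiling_le_iff)
      then show ?thesis by (simp only: sets_deg)
    qed
    then show ?thesis by (simp add: borel_measurable_iff_ge)
  qed
  have XM [measurable]: "X n \<in> borel_measurable M" for n
  proof (cases "n = 0")
    case True
    then show ?thesis by (simp add: X_def)
  next
    case False
    show ?thesis unfolding X_def V_def
      by (rule borel_measurable_Max) (auto simp: False)
  qed
  have "(\<lambda>n. prob {\<omega> \<in> space M. \<epsilon> < \<bar>X n \<omega> - - a\<bar>}) \<longlonglongrightarrow> 0" if \<epsilon>: "0 < \<epsilon>" for \<epsilon>
  proof (rule LIMSEQ_I)
    fix e :: real assume e: "0 < e"
    have "filterlim (\<lambda>x. log \<theta> x) at_top at_top"
    proof -
      have "0 < ln \<theta>" using theta_gt_1 by simp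
      then show ?thesis unfolding log_def by real_asymp
    qed
    then have "eventually (\<lambda>x. 0 < log \<theta> x) at_top"
      unfolding filterlim_at_top_dense by blast
    from eventually_compose_filterlim[OF this filterlim_log_theta]
    have "eventually (\<lambda>n. 0 < log \<theta> (log \<theta> (real n))) sequentially" .
    moreover have "eventually (\<lambda>n. prob {\<omega> \<in> space M. \<exists>i\<in>{1..n}.
        log \<theta> (real n) - (a - \<epsilon>) * log \<theta> (log \<theta> (real n)) < real (deg n i \<omega>)} < e / 2) sequentially"
      using \<epsilon> e by (intro upper_event_small) auto
    moreover have "eventually (\<lambda>n. prob {\<omega> \<in> space M. \<forall>i\<in>{1..n}.
        real (deg n i \<omega>) < log \<theta> (real n) - (a + \<epsilon>) * log \<theta> (log \<theta> (real n))} < e / 2) sequentially"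
      using \<epsilon> e by (intro lower_event_small) auto
    ultimately have "eventually (\<lambda>n. norm (prob {\<omega> \<in> space M. \<epsilon> < \<bar>X n \<omega> - - a\<bar>} - 0) < e) sequentially"
      using eventually_ge_at_top[of 1]
    proof eventually_elim
      case (elim n)
      define l where "l = log \<theta> (log \<theta> (real n))"
      have l: "0 < l" using elim by (simp add: l_def)
      let ?U = "{\<omega> \<in> space M. \<exists>i\<in>{1..n}. log \<theta> (real n) - (a - \<epsilon>) * l < real (deg n i \<omega>)}"
      let ?D = "{\<omega> \<in> space M. \<forall>i\<in>{1..n}. real (deg n i \<omega>) < log \<theta> (real n) - (a + \<epsilon>) * l}"
      have UD: "?U \<in> sets M" "?D \<in> sets M" by measurable
      have "{\<omega> \<in> space M. \<epsilon> < \<bar>X n \<omega> - - a\<bar>} \<subseteq> ?U \<union> ?D"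
      proof (rule subsetI, rule ccontr)
        fix \<omega> assume "\<omega> \<in> {\<omega> \<in> space M. \<epsilon> < \<bar>X n \<omega> - - a\<bar>}" and not: "\<omega> \<notin> ?U \<union> ?D"
        then have \<omega>: "\<omega> \<in> space M" "\<epsilon> < \<bar>X n \<omega> - - a\<bar>" "\<omega> \<notin> ?D" by auto
        have fin: "finite ((\<lambda>i. V n i \<omega>) ` {1..n})" "(\<lambda>i. V n i \<omega>) ` {1..n} \<noteq> {}"
          using elim by auto
        obtain j where j: "j \<in> {1..n}" "log \<theta> (real n) - (a + \<epsilon>) * l \<le> real (deg n j \<omega>)"
          using \<omega> by (auto simp: not_less)
        then have "- (a + \<epsilon>) \<le> V n j \<omega>"
          using l by (simp add: V_def l_def[symmetric] le_divide_eq algebra_simps)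
        also have "\<dots> \<le> X n \<omega>" unfolding X_def using fin j by (intro Max_ge) auto
        finally have "- a + \<epsilon> < X n \<omega>" using \<omega>(2) by (simp add: abs_if split: if_splits)
        moreover have "X n \<omega> \<in> (\<lambda>i. V n i \<omega>) ` {1..n}" unfolding X_def using fin by (rule Max_in)
        ultimately obtain i where i: "i \<in> {1..n}" "- a + \<epsilon> < V n i \<omega>" by auto
        then have "log \<theta> (real n) - (a - \<epsilon>) * l < real (deg n i \<omega>)"
          using l by (simp add: V_def l_def[symmetric] less_divide_eq algebra_simps)
        then show False using i(1) \<omega>(1) not by blast
      qed
      then have "prob {\<omega> \<in> space M. \<epsilon> < \<bar>X n \<omega> - - a\<bar>} \<le> prob (?U \<union> ?D)"
        using UD by (intro finite_measure_mono) auto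
      also have "\<dots> \<le> prob ?U + prob ?D" using UD by (intro measure_Un_le)
      also have "\<dots> < e" using elim(2,3) by (simp add: l_def)
      finally show ?case by simp
    qed
    then show "\<exists>N. \<forall>n\<ge>N. norm (prob {\<omega> \<in> space M. \<epsilon> < \<bar>X n \<omega> - - a\<bar>} - 0) < e"
      unfolding eventually_sequentially .
  qed
  then have "tendsto_in_prob M X (\<lambda>_. - a)"
    unfolding tendsto_in_prob_def using XM by simp
  then show ?thesis by (simp add: X_def[abs_def] V_def[abs_def])
qed

end

theorem theorem2p6:
  fixes M :: "'a measure" and \<mu> :: "real measure"
    and W :: "nat \<Rightarrow> 'a \<Rightarrow> real" and parent :: "nat \<Rightarrow> 'a \<Rightarrow> nat"
    and C \<rho> x1 \<alpha> \<theta> :: real and L :: "real \<Rightarrow> real"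
  assumes wrt: "weighted_recursive_tree M \<mu> W parent"
    and support: "AE x in \<mu>. 0 < x \<and> x \<le> 1"
    and endpoint: "Sup {x. cdf \<mu> x < 1} = 1"
    and lower: "C > 0" "\<rho> > 0" "0 < x1" "x1 < 1"
      "\<And>x. 0 \<le> x \<Longrightarrow> x \<le> x1 \<Longrightarrow> cdf \<mu> x \<le> C * x powr \<rho>"
    and mda: "weibull_max_domain \<mu>"
    and alpha: "\<alpha> > 1"
    and slow: "\<And>x. x > 0 \<Longrightarrow> L x > 0" "slowly_varying L"
    and upper: "\<And>x. x > 0 \<Longrightarrow> measure \<mu> {1 - 1 / x..} = L x * x powr (- (\<alpha> - 1))"
    and theta: "\<theta> = 1 + (\<integral>x. x \<partial>\<mu>)"
  shows "tendsto_in_prob M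
    (\<lambda>n \<omega>. MAX i\<in>{1..n}.
       (real (in_degree (wrt_tree parent n \<omega>) i) - log \<theta> (real n)) / log \<theta> (log \<theta> (real n)))
    (\<lambda>_. - (\<alpha> - 1))"
proof -
  interpret weighted_recursive_tree M \<mu> W parent by (rule wrt)
  interpret weibull_weighted_recursive_tree M \<mu> W parent "\<alpha> - 1" L
  proof unfold_locales
    show "AE x in \<mu>. x \<le> 1" using support by eventually_elim simp
  qed (use alpha slow upper in auto)
  have "\<theta> = weibull_weighted_recursive_tree.\<theta> \<mu>"
    using theta by (simp add: \<theta>_def mean_W_def)
  then show ?thesis
    using max_degree_limit by (simp add: in_degree_wrt_tree deg_def)
qed

end
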